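(* There are operator spaces $X$ and $Y$ such that (1) $X$ linearly isomorphically embeds into $Y$ (as a Banach space), (2) $X$ does not completely isomorphically embed into $Y$, and (3) the bounded subsets of $X$ and $Y$ are almost completely coarsely equivalent.
   Context: An operator space is a closed linear subspace $X$ of $\mathcal{B}(H)$ for some complex Hilbert space $H$. For $n\in\mathbb{N}$, $\mathrm{M}_n(X)$ is the space of $n\times n$ matrices over $X$ with the norm inherited from $\mathrm{M}_n(\mathcal{B}(H))\cong\mathcal{B}(H^{\oplus n})$. For a (not necessarily linear) map $f\colon X\to Y$, its $n$-th amplification is $f_n\colon\mathrm{M}_n(X)\to\mathrm{M}_n(Y)$, $f_n([x_{ij}])=[f(x_{ij})]$. A linear map $f$ is completely bounded if $\sup_n\|f_n\|<\infty$, and a complete isomorphic embedding if it is injective and both $f$ and $f^{-1}\colon f(X)\to X$ are completely bounded. A linear isomorphic embedding is a bounded linear map that is an isomorphism onto its image. $B_E$ denotes the closed unit ball of a Banach space $E$. A sequence $\bar f=(F^n\colon A_n\to B_n)_n$ of maps between metric spaces $(A_n,d_n)$, $(B_n,\partial_n)$ is an equi-coarse embedding (the maps are equi-coarse embeddings) if $\omega_{\bar f}(t)<\infty$ for all $t\ge 0$ and $\lim_{t\to\infty}\rho_{\bar f}(t)=\infty$, where $\omega_{\bar f}(t)=\sup_n\sup\{\partial_n(F^n(x),F^n(y))\mid d_n(x,y)\le t\}$ and $\rho_{\bar f}(t)=\inf_n\inf\{\partial_n(F^n(x),F^n(y))\mid d_n(x,y)\ge t\}$ (with $\inf\emptyset=\infty$).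 The bounded subsets of operator spaces $X$ and $Y$ are almost completely coarsely equivalent if there is a sequence of bijections $(f^n\colon X\to Y)_n$ such that, letting $g^n=(f^n)^{-1}$, the restricted amplifications $(f^n_n\restriction_{n\cdot B_{\mathrm{M}_n(X)}}\colon n\cdot B_{\mathrm{M}_n(X)}\to\mathrm{M}_n(Y))_n$ and $(g^n_n\restriction_{n\cdot B_{\mathrm{M}_n(Y)}}\colon n\cdot B_{\mathrm{M}_n(Y)}\to\mathrm{M}_n(X))_n$ are equi-coarse embeddings. *)

theory Defs
  imports "HOL-Analysis.Analysis"
begin

section \<open>Complex Hilbert spaces\<close>

class complex_hilbert = banach +
  fixes scaleC :: "complex \<Rightarrow> 'a \<Rightarrow> 'a"  (infixr \<open>*\<^sub>C\<close> 75)
    and cinner :: "'a \<Rightarrow> 'a \<Rightarrow> complex"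
  assumes scaleC_add_right: "c *\<^sub>C (x + y) = c *\<^sub>C x + c *\<^sub>C y"
    and scaleC_add_left: "(b + c) *\<^sub>C x = b *\<^sub>C x + c *\<^sub>C x"
    and scaleC_scaleC: "b *\<^sub>C (c *\<^sub>C x) = (b * c) *\<^sub>C x"
    and scaleC_of_real: "complex_of_real r *\<^sub>C x = r *\<^sub>R x"
    and cinner_commute: "cinner x y = cnj (cinner y x)"
    and cinner_add_right: "cinner x (y + z) = cinner x y + cinner x z"
    and cinner_scaleC_right: "cinner x (c *\<^sub>C y) = c * cinner x y"
    and cinner_self: "cinner x x = complex_of_real ((norm x)\<^sup>2)"

lemma norm_scaleC: "norm (c *\<^sub>C x) = cmod c * norm (x :: 'a :: complex_hilbert)"
proof -
  have "cinner (c *\<^sub>C x) (c *\<^sub>C x) = c * (cnj c * cinner x x)"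
    by (metis cinner_commute cinner_scaleC_right complex_cnj_mult)
  then have "complex_of_real ((norm (c *\<^sub>C x))\<^sup>2) = complex_of_real ((cmod c * norm x)\<^sup>2)"
    unfolding cinner_self
    by (simp only: mult.assoc [symmetric] complex_norm_square power_mult_distrib of_real_mult)
  then have "(norm (c *\<^sub>C x))\<^sup>2 = (cmod c * norm x)\<^sup>2"
    by (simp only: of_real_eq_iff)
  then show ?thesis
    by (simp add: power2_eq_iff_nonneg)
qed

lemma bounded_linear_scaleC: "bounded_linear (\<lambda>x :: 'a :: complex_hilbert. c *\<^sub>C x)"
proof (rule bounded_linear_intro)
  fix r :: real and x :: 'a
  show "c *\<^sub>C (r *\<^sub>R x) = r *\<^sub>R (c *\<^sub>C x)"
    by (simp only: scaleC_of_real [symmetric] scaleC_scaleC mult.commute)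
  show "norm (c *\<^sub>C x) \<le> norm x * cmod c"
    by (simp add: norm_scaleC)
qed (rule scaleC_add_right)

subsection \<open>The space of square-summable sequences\<close>

typedef ell2 = "{f :: nat \<Rightarrow> complex. summable (\<lambda>i. (cmod (f i))\<^sup>2)}"
  by (rule exI [of _ "\<lambda>_. 0"]) simp

setup_lifting type_definition_ell2

lemma square_summable_add:
  fixes f g :: "nat \<Rightarrow> complex"
  assumes "summable (\<lambda>i. (cmod (f i))\<^sup>2)" "summable (\<lambda>i. (cmod (g i))\<^sup>2)"
  shows "summable (\<lambda>i. (cmod (f i + g i))\<^sup>2)"
proof (rule summable_comparison_test')
  show "summable (\<lambda>i. 2 * (cmod (f i))\<^sup>2 + 2 * (cmod (g i))\<^sup>2)"
    using assms by (intro summable_add summable_mult)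
  fix i
  have "(cmod (f i + g i))\<^sup>2 \<le> (cmod (f i) + cmod (g i))\<^sup>2"
    by (simp add: norm_triangle_ineq power_mono)
  also have "\<dots> \<le> 2 * (cmod (f i))\<^sup>2 + 2 * (cmod (g i))\<^sup>2"
    using zero_le_power2 [of "cmod (f i) - cmod (g i)"]
    by (simp add: power2_sum power2_diff)
  finally show "norm ((cmod (f i + g i))\<^sup>2) \<le> 2 * (cmod (f i))\<^sup>2 + 2 * (cmod (g i))\<^sup>2"
    by simp
qed

lemma square_summable_scale:
  fixes f :: "nat \<Rightarrow> complex"
  assumes "summable (\<lambda>i. (cmod (f i))\<^sup>2)"
  shows "summable (\<lambda>i. (cmod (c * f i))\<^sup>2)"
  using summable_mult [OF assms, of "(cmod c)\<^sup>2"] by (simp add: norm_mult power_mult_distrib)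

lemma square_summable_mult:
  fixes f g :: "nat \<Rightarrow> complex"
  assumes "summable (\<lambda>i. (cmod (f i))\<^sup>2)" "summable (\<lambda>i. (cmod (g i))\<^sup>2)"
  shows "summable (\<lambda>i. cnj (f i) * g i)"
proof (rule summable_comparison_test')
  show "summable (\<lambda>i. (cmod (f i))\<^sup>2 + (cmod (g i))\<^sup>2)"
    using assms by (rule summable_add)
  fix i
  have "0 \<le> cmod (f i) * cmod (g i)" by simp
  then show "norm (cnj (f i) * g i) \<le> (cmod (f i))\<^sup>2 + (cmod (g i))\<^sup>2"
    using zero_le_power2 [of "cmod (f i) - cmod (g i)"]
    unfolding norm_mult power2_diff complex_mod_cnj by linarith
qed

lemma Re_suminf_self:
  fixes f :: "nat \<Rightarrow> complex"
  assumes "summable (\<lambda>i. (cmod (f i))\<^sup>2)"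
  shows "Re (\<Sum>i. cnj (f i) * f i) = (\<Sum>i. (cmod (f i))\<^sup>2)"
proof -
  have "(\<lambda>i. complex_of_real ((cmod (f i))\<^sup>2)) sums complex_of_real (\<Sum>i. (cmod (f i))\<^sup>2)"
    using assms by (intro sums_of_real summable_sums)
  then have "(\<lambda>i. cnj (f i) * f i) sums complex_of_real (\<Sum>i. (cmod (f i))\<^sup>2)"
    by (simp only: complex_norm_square mult.commute)
  then have "(\<Sum>i. cnj (f i) * f i) = complex_of_real (\<Sum>i. (cmod (f i))\<^sup>2)"
    by (rule sums_unique [symmetric])
  then show ?thesis
    by (simp only: Re_complex_of_real)
qed

instantiation ell2 :: real_inner
begin

lift_definition zero_ell2 :: ell2 is "\<lambda>_. 0" by simp
lift_definition plus_ell2 :: "ell2 \<Rightarrow> ell2 \<Rightarrow> ell2" is "\<lambda>f g i. f i + g i"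
  by (rule square_summable_add)
lift_definition uminus_ell2 :: "ell2 \<Rightarrow> ell2" is "\<lambda>f i. - f i" by simp
lift_definition minus_ell2 :: "ell2 \<Rightarrow> ell2 \<Rightarrow> ell2" is "\<lambda>f g i. f i - g i"
  subgoal for f g using square_summable_add [of f "\<lambda>i. - g i"] by simp
  done
lift_definition scaleR_ell2 :: "real \<Rightarrow> ell2 \<Rightarrow> ell2" is "\<lambda>r f i. complex_of_real r * f i"
  by (rule square_summable_scale)
lift_definition inner_ell2 :: "ell2 \<Rightarrow> ell2 \<Rightarrow> real" is "\<lambda>f g. Re (\<Sum>i. cnj (f i) * g i)" .

definition norm_ell2 :: "ell2 \<Rightarrow> real" where "norm_ell2 x = sqrt (inner x x)"
definition dist_ell2 :: "ell2 \<Rightarrow> ell2 \<Rightarrow> real" where "dist_ell2 x y = norm (x - y)"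
definition sgn_ell2 :: "ell2 \<Rightarrow> ell2" where "sgn_ell2 x = inverse (norm x) *\<^sub>R x"
definition uniformity_ell2 :: "(ell2 \<times> ell2) filter"
  where "uniformity_ell2 = (INF e\<in>{0<..}. principal {(x, y). dist x y < e})"
definition open_ell2 :: "ell2 set \<Rightarrow> bool"
  where "open_ell2 U = (\<forall>x\<in>U. \<forall>\<^sub>F (x', y) in uniformity. x' = x \<longrightarrow> y \<in> U)"

instance
proof
  fix a b :: real and x y z :: ell2
  show "x + y + z = x + (y + z)" by transfer (simp add: algebra_simps)
  show "x + y = y + x" by transfer (simp add: algebra_simps)
  show "0 + x = x" by transfer simp
  show "- x + x = 0" by transfer simp
  show "x - y = x + - y" by transfer simp
  show "a *\<^sub>R (x + y) = a *\<^sub>R x + a *\<^sub>R y" by transfer (simp add: algebra_simps)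
  show "(a + b) *\<^sub>R x = a *\<^sub>R x + b *\<^sub>R x" by transfer (simp add: algebra_simps)
  show "a *\<^sub>R b *\<^sub>R x = (a * b) *\<^sub>R x" by transfer (simp add: algebra_simps)
  show "1 *\<^sub>R x = x" by transfer simp
  show "sgn x = inverse (norm x) *\<^sub>R x" by (simp add: sgn_ell2_def)
  show "dist x y = norm (x - y)" by (rule dist_ell2_def)
  show "uniformity = (INF e\<in>{0<..}. principal {(x :: ell2, y). dist x y < e})"
    by (rule uniformity_ell2_def)
  show "open U = (\<forall>x\<in>U. \<forall>\<^sub>F (x', y) in uniformity. x' = x \<longrightarrow> y \<in> U)" for U :: "ell2 set"
    by (rule open_ell2_def)
  show "norm x = sqrt (inner x x)" by (rule norm_ell2_def)
  show "inner x y = inner y x"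
  proof transfer
    fix f g :: "nat \<Rightarrow> complex"
    assume "summable (\<lambda>i. (cmod (f i))\<^sup>2)" "summable (\<lambda>i. (cmod (g i))\<^sup>2)"
    then have "Re (\<Sum>i. cnj (f i) * g i) = (\<Sum>i. Re (cnj (f i) * g i))"
      "Re (\<Sum>i. cnj (g i) * f i) = (\<Sum>i. Re (cnj (g i) * f i))"
      by (simp_all add: Re_suminf square_summable_mult)
    then show "Re (\<Sum>i. cnj (f i) * g i) = Re (\<Sum>i. cnj (g i) * f i)"
      by (simp add: mult.commute)
  qed
  show "inner (x + y) z = inner x z + inner y z"
  proof transfer
    fix f g h :: "nat \<Rightarrow> complex"
    assume "summable (\<lambda>i. (cmod (f i))\<^sup>2)" "summable (\<lambda>i. (cmod (g i))\<^sup>2)"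
      "summable (\<lambda>i. (cmod (h i))\<^sup>2)"
    then have "(\<Sum>i. cnj (f i) * h i) + (\<Sum>i. cnj (g i) * h i)
        = (\<Sum>i. cnj (f i) * h i + cnj (g i) * h i)"
      by (intro suminf_add square_summable_mult)
    then show "Re (\<Sum>i. cnj (f i + g i) * h i)
        = Re (\<Sum>i. cnj (f i) * h i) + Re (\<Sum>i. cnj (g i) * h i)"
      unfolding complex_cnj_add distrib_right by (simp only: plus_complex.sel [symmetric])
  qed
  show "inner (a *\<^sub>R x) y = a * inner x y"
  proof transfer
    fix a :: real and f g :: "nat \<Rightarrow> complex"
    assume "summable (\<lambda>i. (cmod (f i))\<^sup>2)" "summable (\<lambda>i. (cmod (g i))\<^sup>2)"
    then have "(\<Sum>i. of_real a * (cnj (f i) * g i)) = of_real a * (\<Sum>i. cnj (f i) * g i)"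
      by (intro suminf_mult square_summable_mult)
    then show "Re (\<Sum>i. cnj (of_real a * f i) * g i) = a * Re (\<Sum>i. cnj (f i) * g i)"
      by (simp add: mult.assoc)
  qed
  show "0 \<le> inner x x"
    by transfer (simp only: Re_suminf_self suminf_nonneg zero_le_power2)
  show "inner x x = 0 \<longleftrightarrow> x = 0"
    by transfer (auto simp add: Re_suminf_self suminf_eq_zero_iff fun_eq_iff)
qed

end

lemma norm_ell2_square: "(norm x)\<^sup>2 = (\<Sum>i. (cmod (Rep_ell2 x i))\<^sup>2)"
proof -
  have "inner x x = (\<Sum>i. (cmod (Rep_ell2 x i))\<^sup>2)"
    using Rep_ell2 [of x]
    by (simp add: inner_ell2.rep_eq Re_suminf_self)
  then show ?thesis
    by (simp add: power2_norm_eq_inner)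
qed

lemma sum_le_norm_ell2: "(\<Sum>i<k. (cmod (Rep_ell2 x i))\<^sup>2) \<le> (norm x)\<^sup>2"
  unfolding norm_ell2_square using Rep_ell2 [of x] by (intro sum_le_suminf) auto

lemma coord_le_norm_ell2: "cmod (Rep_ell2 x i) \<le> norm x"
proof -
  have "(cmod (Rep_ell2 x i))\<^sup>2 \<le> (\<Sum>j<Suc i. (cmod (Rep_ell2 x j))\<^sup>2)"
    by (rule member_le_sum) auto
  also have "\<dots> \<le> (norm x)\<^sup>2" by (rule sum_le_norm_ell2)
  finally show ?thesis by (simp add: power2_le_iff_abs_le)
qed

instance ell2 :: complete_space
proof
  fix X :: "nat \<Rightarrow> ell2"
  assume X: "Cauchy X"
  have "Cauchy (\<lambda>n. Rep_ell2 (X n) i)" for i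
  proof (rule CauchyI)
    fix e :: real assume "0 < e"
    then obtain M where "\<forall>m\<ge>M. \<forall>n\<ge>M. norm (X m - X n) < e"
      using CauchyD [OF X] by blast
    then show "\<exists>M. \<forall>m\<ge>M. \<forall>n\<ge>M. norm (Rep_ell2 (X m) i - Rep_ell2 (X n) i) < e"
      by (metis coord_le_norm_ell2 minus_ell2.rep_eq order_le_less_trans)
  qed
  then have "\<exists>l. (\<lambda>n. Rep_ell2 (X n) i) \<longlonglongrightarrow> l" for i
    by (simp add: Cauchy_convergent_iff convergent_def)
  then obtain f where f: "\<And>i. (\<lambda>n. Rep_ell2 (X n) i) \<longlonglongrightarrow> f i" by metis
  have bound: "(\<Sum>i<k. (cmod (Rep_ell2 (X m) i - f i))\<^sup>2) \<le> e\<^sup>2"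
    if M: "\<forall>m\<ge>M. \<forall>n\<ge>M. norm (X m - X n) < e" and "m \<ge> M" for M e m k
  proof (rule LIMSEQ_le_const2)
    show "(\<lambda>n. \<Sum>i<k. (cmod (Rep_ell2 (X m) i - Rep_ell2 (X n) i))\<^sup>2)
        \<longlonglongrightarrow> (\<Sum>i<k. (cmod (Rep_ell2 (X m) i - f i))\<^sup>2)"
      by (intro tendsto_intros f)
    have "(\<Sum>i<k. (cmod (Rep_ell2 (X m) i - Rep_ell2 (X n) i))\<^sup>2) \<le> e\<^sup>2" if "n \<ge> M" for n
    proof -
      have "(\<Sum>i<k. (cmod (Rep_ell2 (X m) i - Rep_ell2 (X n) i))\<^sup>2) \<le> (norm (X m - X n))\<^sup>2"
        using sum_le_norm_ell2 [of "X m - X n" k] by (simp add: minus_ell2.rep_eq)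
      also have "\<dots> \<le> e\<^sup>2"
        by (rule power_mono [OF less_imp_le norm_ge_zero]) (use M \<open>m \<ge> M\<close> that in blast)
      finally show ?thesis .
    qed
    then show "\<exists>N. \<forall>n\<ge>N. (\<Sum>i<k. (cmod (Rep_ell2 (X m) i - Rep_ell2 (X n) i))\<^sup>2) \<le> e\<^sup>2"
      by blast
  qed
  have summ: "summable (\<lambda>i. (cmod (Rep_ell2 (X m) i - f i))\<^sup>2)"
    and le: "(\<Sum>i. (cmod (Rep_ell2 (X m) i - f i))\<^sup>2) \<le> e\<^sup>2"
    if "\<forall>m\<ge>M. \<forall>n\<ge>M. norm (X m - X n) < e" "m \<ge> M" for M e m
  proof -
    show "summable (\<lambda>i. (cmod (Rep_ell2 (X m) i - f i))\<^sup>2)"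
    proof (rule bounded_imp_summable)
      show "(\<Sum>i\<le>k. (cmod (Rep_ell2 (X m) i - f i))\<^sup>2) \<le> e\<^sup>2" for k
        unfolding lessThan_Suc_atMost [symmetric] by (rule bound [OF that])
    qed simp
    then show "(\<Sum>i. (cmod (Rep_ell2 (X m) i - f i))\<^sup>2) \<le> e\<^sup>2"
      using bound [OF that] by (intro suminf_le_const)
  qed
  obtain M where M: "\<forall>m\<ge>M. \<forall>n\<ge>M. norm (X m - X n) < 1"
    using CauchyD [OF X, of 1] by auto
  have "summable (\<lambda>i. (cmod (Rep_ell2 (X M) i))\<^sup>2)"
    using Rep_ell2 [of "X M"] by simp
  then have "summable (\<lambda>i. (cmod (Rep_ell2 (X M) i + (-1) * (Rep_ell2 (X M) i - f i)))\<^sup>2)"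
    by (rule square_summable_add [OF _ square_summable_scale [OF summ [OF M order_refl]]])
  then have "summable (\<lambda>i. (cmod (f i))\<^sup>2)"
    by simp
  then obtain L where L: "Rep_ell2 L = f"
    using Abs_ell2_inverse [of f] by blast
  have "X \<longlonglongrightarrow> L"
  proof (rule LIMSEQ_I)
    fix e :: real assume "0 < e"
    then obtain M where M: "\<forall>m\<ge>M. \<forall>n\<ge>M. norm (X m - X n) < e / 2"
      using CauchyD [OF X, of "e / 2"] by auto
    have "norm (X m - L) < e" if "m \<ge> M" for m
    proof -
      have "(norm (X m - L))\<^sup>2 \<le> (e / 2)\<^sup>2"
        using le [OF M that] by (simp add: norm_ell2_square minus_ell2.rep_eq L)
      then have "norm (X m - L) \<le> e / 2"
        by (rule power2_le_imp_le) (use \<open>0 < e\<close> in simp)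
      then show ?thesis using \<open>0 < e\<close> by simp
    qed
    then show "\<exists>no. \<forall>n\<ge>no. norm (X n - L) < e" by blast
  qed
  then show "convergent X" by (auto simp: convergent_def)
qed

instance ell2 :: banach ..

instantiation ell2 :: complex_hilbert
begin

lift_definition scaleC_ell2 :: "complex \<Rightarrow> ell2 \<Rightarrow> ell2" is "\<lambda>c f i. c * f i"
  by (rule square_summable_scale)
lift_definition cinner_ell2 :: "ell2 \<Rightarrow> ell2 \<Rightarrow> complex" is "\<lambda>f g. \<Sum>i. cnj (f i) * g i" .

instance
proof
  fix b c :: complex and r :: real and x y z :: ell2
  show "c *\<^sub>C (x + y) = c *\<^sub>C x + c *\<^sub>C y" by transfer (simp add: algebra_simps)
  show "(b + c) *\<^sub>C x = b *\<^sub>C x + c *\<^sub>C x" by transfer (simp add: algebra_simps)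
  show "b *\<^sub>C c *\<^sub>C x = (b * c) *\<^sub>C x" by transfer (simp add: algebra_simps)
  show "complex_of_real r *\<^sub>C x = r *\<^sub>R x" by transfer simp
  show "cinner x y = cnj (cinner y x)"
  proof transfer
    fix f g :: "nat \<Rightarrow> complex"
    assume "summable (\<lambda>i. (cmod (f i))\<^sup>2)" "summable (\<lambda>i. (cmod (g i))\<^sup>2)"
    then have "(\<lambda>i. cnj (cnj (g i) * f i)) sums cnj (\<Sum>i. cnj (g i) * f i)"
      by (intro sums_cnj [THEN iffD2] summable_sums square_summable_mult)
    then show "(\<Sum>i. cnj (f i) * g i) = cnj (\<Sum>i. cnj (g i) * f i)"
      by (simp add: mult.commute sums_iff)
  qed
  show "cinner x (y + z) = cinner x y + cinner x z"
    by transfer (simp only: distrib_left suminf_add square_summable_mult)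
  show "cinner x (c *\<^sub>C y) = c * cinner x y"
  proof transfer
    fix c :: complex and f g :: "nat \<Rightarrow> complex"
    assume "summable (\<lambda>i. (cmod (f i))\<^sup>2)" "summable (\<lambda>i. (cmod (g i))\<^sup>2)"
    then have "(\<Sum>i. c * (cnj (f i) * g i)) = c * (\<Sum>i. cnj (f i) * g i)"
      by (intro suminf_mult square_summable_mult)
    then show "(\<Sum>i. cnj (f i) * (c * g i)) = c * (\<Sum>i. cnj (f i) * g i)"
      by (simp add: mult.left_commute)
  qed
  have "(\<lambda>i. complex_of_real ((cmod (Rep_ell2 x i))\<^sup>2)) sums
      complex_of_real (\<Sum>i. (cmod (Rep_ell2 x i))\<^sup>2)"
    using Rep_ell2 [of x] by (intro sums_of_real summable_sums) simp
  then have "(\<Sum>i. complex_of_real ((cmod (Rep_ell2 x i))\<^sup>2)) = complex_of_real ((norm x)\<^sup>2)"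
    unfolding norm_ell2_square by (rule sums_unique [symmetric])
  then show "cinner x x = complex_of_real ((norm x)\<^sup>2)"
    unfolding cinner_ell2.rep_eq complex_norm_square by (simp add: mult.commute)
qed

end

section \<open>Operator spaces and their matrix norms\<close>

text \<open>
  The type of bounded \<^emph>\<open>real\<close>-linear maps carries the operator norm, and \<open>B(H)\<close> is the
  (closed) subset of its complex-linear elements.
\<close>

definition bounded_ops :: "('h :: complex_hilbert \<Rightarrow>\<^sub>L 'h) set"
  where "bounded_ops = {T. \<forall>c x. blinfun_apply T (c *\<^sub>C x) = c *\<^sub>C blinfun_apply T x}"

definition scale_op ::
    "complex \<Rightarrow> ('h :: complex_hilbert \<Rightarrow>\<^sub>L 'h) \<Rightarrow> ('h \<Rightarrow>\<^sub>L 'h)"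
  where "scale_op c T = Blinfun (\<lambda>x. c *\<^sub>C blinfun_apply T x)"

lemma scale_op_apply: "blinfun_apply (scale_op c T) x = c *\<^sub>C blinfun_apply T x"
proof -
  have "bounded_linear (\<lambda>x. c *\<^sub>C blinfun_apply T x)"
    by (rule bounded_linear_compose [OF bounded_linear_scaleC blinfun.bounded_linear_right])
  then show ?thesis
    by (simp add: scale_op_def bounded_linear_Blinfun_apply)
qed

definition operator_space :: "('h :: complex_hilbert \<Rightarrow>\<^sub>L 'h) set \<Rightarrow> bool"
  where "operator_space X \<longleftrightarrow>
    X \<subseteq> bounded_ops \<and> 0 \<in> X \<and> (\<forall>S\<in>X. \<forall>T\<in>X. S + T \<in> X) \<and>
    (\<forall>c. \<forall>T\<in>X. scale_op c T \<in> X) \<and> closed X"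

text \<open>
  An \<open>n \<times> n\<close> matrix is a doubly indexed family vanishing outside the index square, so that
  equality of families is equality of matrices.
\<close>

type_synonym 'h op_matrix = "nat \<Rightarrow> nat \<Rightarrow> ('h \<Rightarrow>\<^sub>L 'h)"

definition matrices ::
    "nat \<Rightarrow> ('h :: complex_hilbert \<Rightarrow>\<^sub>L 'h) set \<Rightarrow> 'h op_matrix set"
  where "matrices n X =
    {A. (\<forall>i<n. \<forall>j<n. A i j \<in> X) \<and> (\<forall>i j. \<not> (i < n \<and> j < n) \<longrightarrow> A i j = 0)}"

text \<open>
  The operator norm of the matrix acting on the Hilbert sum of \<open>n\<close> copies of \<open>H\<close>, whose
  elements are represented by the first \<open>n\<close> entries of sequences in \<open>H\<close>.
\<close>

definition mat_norm :: "nat \<Rightarrow> 'h :: complex_hilbert op_matrix \<Rightarrow> real"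
  where "mat_norm n A =
    (SUP \<xi> \<in> {\<xi> :: nat \<Rightarrow> 'h. L2_set (\<lambda>j. norm (\<xi> j)) {..<n} \<le> 1}.
      L2_set (\<lambda>i. norm (\<Sum>j<n. blinfun_apply (A i j) (\<xi> j))) {..<n})"

lemma bdd_above_mat_norm:
  fixes A :: "'h :: complex_hilbert op_matrix"
  shows "bdd_above ((\<lambda>\<xi>. L2_set (\<lambda>i. norm (\<Sum>j<n. blinfun_apply (A i j) (\<xi> j))) {..<n}) `
    {\<xi>. L2_set (\<lambda>j. norm (\<xi> j)) {..<n} \<le> 1})"
proof (rule bdd_aboveI2)
  fix \<xi> :: "nat \<Rightarrow> 'h"
  assume "\<xi> \<in> {\<xi>. L2_set (\<lambda>j. norm (\<xi> j)) {..<n} \<le> 1}"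
  then have le1: "norm (\<xi> j) \<le> 1" if "j < n" for j
    using member_le_L2_set [of "{..<n}" j "\<lambda>j. norm (\<xi> j)"] that by simp
  have "L2_set (\<lambda>i. norm (\<Sum>j<n. blinfun_apply (A i j) (\<xi> j))) {..<n}
      \<le> (\<Sum>i<n. norm (\<Sum>j<n. blinfun_apply (A i j) (\<xi> j)))"
    by (rule L2_set_le_sum) simp
  also have "\<dots> \<le> (\<Sum>i<n. \<Sum>j<n. norm (A i j))"
  proof (intro sum_mono order_trans [OF norm_sum])
    fix i j assume "j \<in> {..<n}"
    then have "norm (A i j) * norm (\<xi> j) \<le> norm (A i j)"
      using le1 by (intro mult_left_le) auto
    then show "norm (blinfun_apply (A i j) (\<xi> j)) \<le> norm (A i j)"
      by (rule order_trans [OF norm_blinfun])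
  qed
  finally show "L2_set (\<lambda>i. norm (\<Sum>j<n. blinfun_apply (A i j) (\<xi> j))) {..<n}
      \<le> (\<Sum>i<n. \<Sum>j<n. norm (A i j))" .
qed

definition mat_dist ::
    "nat \<Rightarrow> 'h :: complex_hilbert op_matrix \<Rightarrow> 'h op_matrix \<Rightarrow> real"
  where "mat_dist n A B = mat_norm n (\<lambda>i j. A i j - B i j)"

definition mat_ball ::
    "nat \<Rightarrow> ('h :: complex_hilbert \<Rightarrow>\<^sub>L 'h) set \<Rightarrow> real \<Rightarrow> 'h op_matrix set"
  where "mat_ball n X r = {A \<in> matrices n X. mat_norm n A \<le> r}"

definition amplification ::
    "nat \<Rightarrow> (('h :: complex_hilbert \<Rightarrow>\<^sub>L 'h) \<Rightarrow> ('k :: complex_hilbert \<Rightarrow>\<^sub>L 'k))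
      \<Rightarrow> 'h op_matrix \<Rightarrow> 'k op_matrix"
  where "amplification n f A = (\<lambda>i j. if i < n \<and> j < n then f (A i j) else 0)"

section \<open>Linear embeddings\<close>

definition clinear_map_on ::
    "('h :: complex_hilbert \<Rightarrow>\<^sub>L 'h) set
      \<Rightarrow> (('h \<Rightarrow>\<^sub>L 'h) \<Rightarrow> ('k :: complex_hilbert \<Rightarrow>\<^sub>L 'k)) \<Rightarrow> bool"
  where "clinear_map_on X f \<longleftrightarrow>
    (\<forall>S\<in>X. \<forall>T\<in>X. f (S + T) = f S + f T) \<and>
    (\<forall>c. \<forall>T\<in>X. f (scale_op c T) = scale_op c (f T))"

definition bounded_map_on ::
    "('h :: complex_hilbert \<Rightarrow>\<^sub>L 'h) set
      \<Rightarrow> (('h \<Rightarrow>\<^sub>L 'h) \<Rightarrow> ('k :: complex_hilbert \<Rightarrow>\<^sub>L 'k)) \<Rightarrow> bool"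
  where "bounded_map_on X f \<longleftrightarrow>
    clinear_map_on X f \<and> (\<exists>C. \<forall>T\<in>X. norm (f T) \<le> C * norm T)"

definition linear_isomorphic_embedding ::
    "('h :: complex_hilbert \<Rightarrow>\<^sub>L 'h) set \<Rightarrow> ('k :: complex_hilbert \<Rightarrow>\<^sub>L 'k) set
      \<Rightarrow> (('h \<Rightarrow>\<^sub>L 'h) \<Rightarrow> ('k \<Rightarrow>\<^sub>L 'k)) \<Rightarrow> bool"
  where "linear_isomorphic_embedding X Y f \<longleftrightarrow>
    f \<in> X \<rightarrow> Y \<and> inj_on f X \<and> bounded_map_on X f \<and> bounded_map_on (f ` X) (inv_into X f)"

definition amplification_norm ::
    "nat \<Rightarrow> ('h :: complex_hilbert \<Rightarrow>\<^sub>L 'h) set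
      \<Rightarrow> (('h \<Rightarrow>\<^sub>L 'h) \<Rightarrow> ('k :: complex_hilbert \<Rightarrow>\<^sub>L 'k)) \<Rightarrow> ennreal"
  where "amplification_norm n X f =
    (SUP A \<in> mat_ball n X 1. ennreal (mat_norm n (amplification n f A)))"

definition completely_bounded_on ::
    "('h :: complex_hilbert \<Rightarrow>\<^sub>L 'h) set
      \<Rightarrow> (('h \<Rightarrow>\<^sub>L 'h) \<Rightarrow> ('k :: complex_hilbert \<Rightarrow>\<^sub>L 'k)) \<Rightarrow> bool"
  where "completely_bounded_on X f \<longleftrightarrow>
    clinear_map_on X f \<and> (SUP n \<in> {1..}. amplification_norm n X f) < \<infinity>"

definition complete_isomorphic_embedding ::
    "('h :: complex_hilbert \<Rightarrow>\<^sub>L 'h) set \<Rightarrow> ('k :: complex_hilbert \<Rightarrow>\<^sub>L 'k) set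
      \<Rightarrow> (('h \<Rightarrow>\<^sub>L 'h) \<Rightarrow> ('k \<Rightarrow>\<^sub>L 'k)) \<Rightarrow> bool"
  where "complete_isomorphic_embedding X Y f \<longleftrightarrow>
    f \<in> X \<rightarrow> Y \<and> inj_on f X \<and> completely_bounded_on X f \<and>
    completely_bounded_on (f ` X) (inv_into X f)"

section \<open>Coarse geometry\<close>

text \<open>
  Sequences are indexed by \<open>n \<ge> 1\<close>. A sequence of metric spaces is given by carriers \<open>A n\<close>
  with distances \<open>d n\<close>. The infimum of the empty set in \<^typ>\<open>ennreal\<close> is \<open>\<infinity>\<close>.
\<close>

definition expansion_modulus ::
    "(nat \<Rightarrow> 'a set) \<Rightarrow> (nat \<Rightarrow> 'a \<Rightarrow> 'a \<Rightarrow> real) \<Rightarrow> (nat \<Rightarrow> 'b \<Rightarrow> 'b \<Rightarrow> real)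
      \<Rightarrow> (nat \<Rightarrow> 'a \<Rightarrow> 'b) \<Rightarrow> real \<Rightarrow> ennreal"
  where "expansion_modulus A d e F t =
    (SUP n \<in> {1..}. SUP (x, y) \<in> {(x, y). x \<in> A n \<and> y \<in> A n \<and> d n x y \<le> t}.
      ennreal (e n (F n x) (F n y)))"

definition compression_modulus ::
    "(nat \<Rightarrow> 'a set) \<Rightarrow> (nat \<Rightarrow> 'a \<Rightarrow> 'a \<Rightarrow> real) \<Rightarrow> (nat \<Rightarrow> 'b \<Rightarrow> 'b \<Rightarrow> real)
      \<Rightarrow> (nat \<Rightarrow> 'a \<Rightarrow> 'b) \<Rightarrow> real \<Rightarrow> ennreal"
  where "compression_modulus A d e F t =
    (INF n \<in> {1..}. INF (x, y) \<in> {(x, y). x \<in> A n \<and> y \<in> A n \<and> d n x y \<ge> t}.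
      ennreal (e n (F n x) (F n y)))"

definition equi_coarse_embedding ::
    "(nat \<Rightarrow> 'a set) \<Rightarrow> (nat \<Rightarrow> 'a \<Rightarrow> 'a \<Rightarrow> real)
      \<Rightarrow> (nat \<Rightarrow> 'b set) \<Rightarrow> (nat \<Rightarrow> 'b \<Rightarrow> 'b \<Rightarrow> real) \<Rightarrow> (nat \<Rightarrow> 'a \<Rightarrow> 'b) \<Rightarrow> bool"
  where "equi_coarse_embedding A d B e F \<longleftrightarrow>
    (\<forall>n\<ge>1. F n \<in> A n \<rightarrow> B n) \<and>
    (\<forall>t\<ge>0. expansion_modulus A d e F t < \<infinity>) \<and>
    (compression_modulus A d e F \<longlongrightarrow> \<infinity>) at_top"

definition bounded_subsets_almost_completely_coarsely_equivalent ::
    "('h :: complex_hilbert \<Rightarrow>\<^sub>L 'h) set \<Rightarrow> ('k :: complex_hilbert \<Rightarrow>\<^sub>L 'k) set \<Rightarrow> bool"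
  where "bounded_subsets_almost_completely_coarsely_equivalent X Y \<longleftrightarrow>
    (\<exists>f :: nat \<Rightarrow> ('h \<Rightarrow>\<^sub>L 'h) \<Rightarrow> ('k \<Rightarrow>\<^sub>L 'k).
      (\<forall>n\<ge>1. bij_betw (f n) X Y) \<and>
      equi_coarse_embedding
        (\<lambda>n. mat_ball n X (real n)) mat_dist (\<lambda>n. matrices n Y) mat_dist
        (\<lambda>n. amplification n (f n)) \<and>
      equi_coarse_embedding
        (\<lambda>n. mat_ball n Y (real n)) mat_dist (\<lambda>n. matrices n X) mat_dist
        (\<lambda>n. amplification n (inv_into X (f n))))"

end

theory Submission
  imports Defs
begin

text \<open>
  Write \<open>C\<close> for the column Hilbert space, that is \<open>\<ell>\<^sub>2\<close> realised as the operators
  with a single nonzero column, and \<open>C\<^sub>n\<close> for its \<open>n\<close>-dimensional version. Let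
  \<open>Y\<close> consist of the families \<open>y(n, j) \<in> C\<^sub>n\<close>, \<open>n, j \<in> \<nat>\<close>,
  with \<open>sup\<^sub>j \<parallel>y(n, j)\<parallel> \<rightarrow> 0\<close> as \<open>n \<rightarrow>
  \<infinity>\<close>, and let \<open>X = C \<oplus> Y\<close> (below, \<open>Y\<close> is called
  \<open>fin_cols\<close> and \<open>X\<close> is called \<open>col_plus_fin\<close>). Both are spaces of direct sums of
  columns, so they act on \<open>\<ell>\<^sub>2\<close>, and a matrix norm over them is the supremum of the matrix norms
  of the blocks (\<open>mat_norm_le_blocks\<close>, \<open>blocks_le_mat_norm\<close>).

  At a fixed matrix level \<open>n\<close> the space \<open>C\<close> cannot be told from a space of columns of length
  \<open>n\<close>: a matrix in \<open>M\<^sub>n(C)\<close> maps a scalar vector to \<open>n\<close> vectors of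
  \<open>\<ell>\<^sub>2\<close>, whose norms survive the projection onto their span, which has rank at most
  \<open>n\<close>. By separability, countably many contractions \<open>C \<rightarrow> C\<^sub>n\<close> suffice to
  norm \<open>M\<^sub>n(C)\<close> up to a factor 4 (\<open>exists_norming_compressions\<close>). Since for every
  \<open>n\<close> the space \<open>Y\<close> contains infinitely many copies of \<open>C\<^sub>n\<close>, there is room
  for a linear map \<open>X \<rightarrow> Y\<close> whose \<open>n\<close>-th amplification is 4-bi-Lipschitz
  (\<open>exists_level_embedding\<close>). The level 1 already gives the linear isomorphic embedding.

  For the coarse equivalence one may use a different bijection at every level, and only its values and those of its
  inverse on balls matter. This decouples the two directions: the level \<open>n\<close> embedding \<open>X
  \<rightarrow> Y\<close> and the inclusion \<open>Y \<subseteq> X\<close> are both translated far away from the ball of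
  radius \<open>n\<close>, and the resulting partial injections, where the range of each avoids the domain of the other,
  extend to a bijection by the Schroeder-Bernstein theorem (\<open>level_bijection_exists\<close>).

  A complete isomorphic embedding \<open>f: X \<rightarrow> Y\<close> does not exist because already \<open>C\<close>
  does not embed. Let \<open>y\<^sub>k\<close> be the images of the unit vectors of \<open>C\<close>. In
  \<open>C\<close> a row of different unit vectors has norm 1, so the rows of the \<open>y\<^sub>k\<close> are bounded,
  by \<open>c\<close> say, whereas a column \<open>(\<lambda>\<^sub>k e\<^sub>k)\<^sub>k\<close> in \<open>C\<close> has
  norm \<open>\<parallel>\<lambda>\<parallel>\<^sub>2\<close>, so the columns \<open>(\<lambda>\<^sub>k
  y\<^sub>k)\<^sub>k\<close> must be large. In a block \<open>C\<^sub>n\<close> a trace estimate turns the bound for the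
  rows into \<open>\<Sum>\<^sub>k \<parallel>y\<^sub>k(n, j)\<parallel>\<^sup>2 \<le> n c\<^sup>2\<close>. If
  \<open>\<lambda>\<close> is spread out over successive and ever longer intervals of \<open>k\<close>, then by this
  bound for small \<open>n\<close>, and by the decay of each \<open>y\<^sub>k\<close> for large \<open>n\<close>, every
  block sees essentially one of these intervals only, and the column \<open>(\<lambda>\<^sub>k
  y\<^sub>k)\<^sub>k\<close> stays bounded although \<open>\<parallel>\<lambda>\<parallel>\<^sub>2\<close> is as large
  as desired (\<open>spreading_weights\<close>, \<open>no_complete_embedding\<close>).
\<close>


section \<open>Coordinates of square-summable sequences\<close>

lemma Rep_ell2_sum: "Rep_ell2 (sum f S) i = (\<Sum>s\<in>S. Rep_ell2 (f s) i)"
  by (induction S rule: infinite_finite_induct) (auto simp: plus_ell2.rep_eq zero_ell2.rep_eq)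

lemma summable_Rep_ell2: "summable (\<lambda>i. (cmod (Rep_ell2 x i))\<^sup>2)"
  using Rep_ell2 [of x] by simp

lemma finite_sum_le_norm_ell2:
  assumes "finite S"
  shows "(\<Sum>i\<in>S. (cmod (Rep_ell2 x i))\<^sup>2) \<le> (norm x)\<^sup>2"
  unfolding norm_ell2_square using summable_Rep_ell2 [of x] assms by (intro sum_le_suminf) auto

lift_definition ket :: "nat \<Rightarrow> ell2" is "\<lambda>p i. if i = p then 1 else 0"
proof -
  fix p :: nat
  show "summable (\<lambda>i. (cmod (if i = p then 1 else 0))\<^sup>2)"
    by (rule summable_finite [of "{p}"]) auto
qed

lemma norm_ket [simp]: "norm (ket p) = 1"
proof -
  have "(norm (ket p))\<^sup>2 = (\<Sum>i\<in>{p}. (cmod (Rep_ell2 (ket p) i))\<^sup>2)"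
    unfolding norm_ell2_square by (rule suminf_finite) (auto simp: ket.rep_eq)
  then have "(norm (ket p))\<^sup>2 = 1\<^sup>2" by (simp add: ket.rep_eq)
  then show ?thesis by (rule power2_eq_imp_eq) auto
qed

text \<open>
  The pairing function identifies \<open>\<nat>\<close> with \<open>\<nat> \<times> \<nat>\<close>, and every initial segment of \<open>\<nat>\<close> is contained
  in a finite square; hence partial sums over squares control the series, and infinite double
  sums never have to be interchanged.
\<close>

lemma summable_box:
  fixes f :: "nat \<Rightarrow> real"
  assumes nonneg: "\<And>k. 0 \<le> f k"
    and box: "\<And>P I. (\<Sum>p<P. \<Sum>i<I. f (prod_encode (p, i))) \<le> M"
  shows "summable f" and "suminf f \<le> M"
proof -
  have le: "sum f {..<m} \<le> M" for m
  proof -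
    obtain L where L: "prod_decode ` {..<m} \<subseteq> {..<L} \<times> {..<L}"
    proof -
      have fin: "finite (fst ` prod_decode ` {..<m} \<union> snd ` prod_decode ` {..<m})" by simp
      obtain L where "\<forall>k \<in> fst ` prod_decode ` {..<m} \<union> snd ` prod_decode ` {..<m}. k < L"
        using finite_nat_set_iff_bounded [THEN iffD1, OF fin] by blast
      then have "prod_decode ` {..<m} \<subseteq> {..<L} \<times> {..<L}"
        by (auto simp: image_subset_iff mem_Times_iff)
      then show ?thesis by (rule that)
    qed
    have "sum f {..<m} = (\<Sum>k\<in>{..<m}. f (prod_encode (prod_decode k)))" by simp
    also have "\<dots> = (\<Sum>q\<in>prod_decode ` {..<m}. f (prod_encode q))"
      by (subst sum.reindex) (auto intro: inj_on_subset [OF inj_prod_decode])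
    also have "\<dots> \<le> (\<Sum>q\<in>{..<L} \<times> {..<L}. f (prod_encode q))"
      using L nonneg by (intro sum_mono2) auto
    also have "\<dots> = (\<Sum>p<L. \<Sum>i<L. f (prod_encode (p, i)))"
      by (simp add: sum.cartesian_product)
    also have "\<dots> \<le> M" by (rule box)
    finally show ?thesis .
  qed
  show "summable f"
  proof (rule bounded_imp_summable)
    show "sum f {..k} \<le> M" for k
      unfolding lessThan_Suc_atMost [symmetric] by (rule le)
  qed (rule nonneg)
  then show "suminf f \<le> M"
    using le by (intro suminf_le_const)
qed

lemma sum_block_le_norm_ell2:
  "(\<Sum>i<I. (cmod (Rep_ell2 v (prod_encode (p, i))))\<^sup>2) \<le> (norm v)\<^sup>2"
proof -
  have "(\<Sum>i<I. (cmod (Rep_ell2 v (prod_encode (p, i))))\<^sup>2)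
      = (\<Sum>k\<in>(\<lambda>i. prod_encode (p, i)) ` {..<I}. (cmod (Rep_ell2 v k))\<^sup>2)"
    by (subst sum.reindex) (auto simp: inj_on_def)
  also have "\<dots> \<le> (norm v)\<^sup>2" by (intro finite_sum_le_norm_ell2) auto
  finally show ?thesis .
qed

lemma sum_norm_le_box:
  fixes w :: "nat \<Rightarrow> ell2"
  assumes "\<And>P I. (\<Sum>p<P. \<Sum>i<I. \<Sum>a<n. (cmod (Rep_ell2 (w a) (prod_encode (p, i))))\<^sup>2) \<le> M"
  shows "(\<Sum>a<n. (norm (w a))\<^sup>2) \<le> M"
proof -
  have "(\<Sum>a<n. (norm (w a))\<^sup>2) = (\<Sum>k. \<Sum>a<n. (cmod (Rep_ell2 (w a) k))\<^sup>2)"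
    unfolding norm_ell2_square by (rule suminf_sum [symmetric]) (rule summable_Rep_ell2)
  also have "\<dots> \<le> M"
    using assms by (intro summable_box) (auto intro: sum_nonneg)
  finally show ?thesis .
qed

section \<open>Matrix norms\<close>

lemma mat_norm_le:
  fixes A :: "'a :: complex_hilbert op_matrix"
  assumes "0 \<le> K"
    and "\<And>\<xi>. L2_set (\<lambda>j. norm (\<xi> j)) {..<n} \<le> 1 \<Longrightarrow>
      L2_set (\<lambda>i. norm (\<Sum>j<n. blinfun_apply (A i j) (\<xi> j))) {..<n} \<le> K"
  shows "mat_norm n A \<le> K"
  unfolding mat_norm_def
proof (rule cSUP_least)
  have "(\<lambda>_. 0) \<in> {\<xi> :: nat \<Rightarrow> 'a. L2_set (\<lambda>j. norm (\<xi> j)) {..<n} \<le> 1}" by (simp add: L2_set_def)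
  then show "{\<xi> :: nat \<Rightarrow> 'a. L2_set (\<lambda>j. norm (\<xi> j)) {..<n} \<le> 1} \<noteq> {}" by (rule ex_in_conv [THEN iffD1, OF exI])
qed (rule assms, simp)

lemma mat_norm_apply_unit:
  assumes "L2_set (\<lambda>j. norm (\<xi> j)) {..<n} \<le> 1"
  shows "L2_set (\<lambda>i. norm (\<Sum>j<n. blinfun_apply (A i j) (\<xi> j))) {..<n} \<le> mat_norm n A"
  unfolding mat_norm_def by (rule cSUP_upper2 [OF bdd_above_mat_norm, of \<xi>]) (use assms in auto)

lemma mat_norm_nonneg: "0 \<le> mat_norm n A"
  using order_trans [OF L2_set_nonneg mat_norm_apply_unit [of "\<lambda>_. 0" n A]] by (simp add: L2_set_def)

lemma mat_norm_apply:
  "L2_set (\<lambda>i. norm (\<Sum>j<n. blinfun_apply (A i j) (\<xi> j))) {..<n}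
    \<le> mat_norm n A * L2_set (\<lambda>j. norm (\<xi> j)) {..<n}"
proof (cases "L2_set (\<lambda>j. norm (\<xi> j)) {..<n} = 0")
  case True
  then have "\<xi> j = 0" if "j < n" for j
    using that by (simp add: L2_set_eq_0_iff)
  then show ?thesis using True by (simp add: L2_set_def)
next
  case False
  define L where "L = L2_set (\<lambda>j. norm (\<xi> j)) {..<n}"
  have L: "L > 0" using False L2_set_nonneg [of "\<lambda>j. norm (\<xi> j)" "{..<n}"] unfolding L_def by linarith
  have scale: "L2_set (\<lambda>i. norm (inverse L *\<^sub>R g i)) {..<n} = inverse L * L2_set (\<lambda>i. norm (g i)) {..<n}"
    for g :: "nat \<Rightarrow> 'a"
    using L by (subst L2_set_right_distrib) (auto intro!: L2_set_cong)
  have "L2_set (\<lambda>j. norm (inverse L *\<^sub>R \<xi> j)) {..<n} \<le> 1"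
    unfolding scale using L by (simp add: L_def [symmetric])
  from mat_norm_apply_unit [OF this, of A]
  have "L2_set (\<lambda>i. norm (inverse L *\<^sub>R (\<Sum>j<n. blinfun_apply (A i j) (\<xi> j)))) {..<n} \<le> mat_norm n A"
    by (simp add: blinfun.scaleR_right scaleR_sum_right)
  then show ?thesis
    unfolding scale L_def [symmetric] using L by (simp add: field_simps)
qed

lemma entry_norm_le_mat_norm:
  fixes A :: "'h :: complex_hilbert op_matrix"
  assumes "i < n" "j < n"
  shows "norm (A i j) \<le> mat_norm n A"
proof (rule norm_blinfun_bound [OF mat_norm_nonneg])
  fix x :: 'h
  let ?\<xi> = "\<lambda>k. if k = j then x else 0"
  have "norm (blinfun_apply (A i j) x) = norm (\<Sum>k<n. blinfun_apply (A i k) (?\<xi> k))"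
    using assms by (simp add: if_distrib [of "blinfun_apply _"] blinfun.zero_right cong: if_cong)
  also have "\<dots> \<le> L2_set (\<lambda>i. norm (\<Sum>k<n. blinfun_apply (A i k) (?\<xi> k))) {..<n}"
    by (rule member_le_L2_set [where f = "\<lambda>i. norm (\<Sum>k<n. blinfun_apply (A i k) (?\<xi> k))"])
      (use assms in auto)
  also have "\<dots> \<le> mat_norm n A * L2_set (\<lambda>k. norm (?\<xi> k)) {..<n}" by (rule mat_norm_apply)
  also have "L2_set (\<lambda>k. norm (?\<xi> k)) {..<n} = norm x"
    using assms by (simp add: L2_set_def if_distrib [of norm] if_distrib [of "\<lambda>r. r\<^sup>2"] cong: if_cong)
  finally show "norm (blinfun_apply (A i j) x) \<le> mat_norm n A * norm x" .
qed

lemma mat_norm_one: "mat_norm 1 A = norm (A 0 0)"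
proof (rule antisym)
  show "norm (A 0 0) \<le> mat_norm 1 A" by (rule entry_norm_le_mat_norm) auto
  show "mat_norm 1 A \<le> norm (A 0 0)"
  proof (rule mat_norm_le)
    fix \<xi> :: "nat \<Rightarrow> 'a"
    assume "L2_set (\<lambda>j. norm (\<xi> j)) {..<1} \<le> 1"
    then have "norm (\<xi> 0) \<le> 1" by (simp add: L2_set_def lessThan_Suc)
    then have "norm (A 0 0) * norm (\<xi> 0) \<le> norm (A 0 0)" by (intro mult_left_le) auto
    then show "L2_set (\<lambda>i. norm (\<Sum>j<1. blinfun_apply (A i j) (\<xi> j))) {..<1} \<le> norm (A 0 0)"
      using norm_blinfun [of "A 0 0" "\<xi> 0"] by (simp add: L2_set_def lessThan_Suc)
  qed simp
qed

section \<open>Operators that are direct sums of columns\<close>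

text \<open>
  The underlying \<open>\<ell>\<^sub>2\<close> is decomposed into infinitely many copies of itself: the \<open>p\<close>-th copy occupies
  the coordinates \<open>prod_encode (p, i)\<close>. The \<open>p\<close>-th column below has its values there.
\<close>

lift_definition unblock :: "nat \<Rightarrow> ell2 \<Rightarrow> ell2" is "\<lambda>p f i. f (prod_encode (p, i))"
proof -
  fix p and f :: "nat \<Rightarrow> complex"
  assume f: "summable (\<lambda>i. (cmod (f i))\<^sup>2)"
  show "summable (\<lambda>i. (cmod (f (prod_encode (p, i))))\<^sup>2)"
  proof (rule bounded_imp_summable)
    fix I
    have "(\<Sum>i\<le>I. (cmod (f (prod_encode (p, i))))\<^sup>2)
        = (\<Sum>k\<in>(\<lambda>i. prod_encode (p, i)) ` {..I}. (cmod (f k))\<^sup>2)"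
      by (subst sum.reindex) (auto simp: inj_on_def)
    also have "\<dots> \<le> (\<Sum>k. (cmod (f k))\<^sup>2)"
      using f by (intro sum_le_suminf) auto
    finally show "(\<Sum>i\<le>I. (cmod (f (prod_encode (p, i))))\<^sup>2) \<le> (\<Sum>k. (cmod (f k))\<^sup>2)" .
  qed simp
qed

lemma norm_unblock_le: "norm (unblock p v) \<le> norm v"
proof -
  have "(norm (unblock p v))\<^sup>2 \<le> (norm v)\<^sup>2"
    unfolding norm_ell2_square [of "unblock p v"] unblock.rep_eq
    using summable_Rep_ell2 [of "unblock p v", unfolded unblock.rep_eq]
    by (intro suminf_le_const sum_block_le_norm_ell2)
  then show ?thesis by (rule power2_le_imp_le) simp
qed

lemma norm_unblock:
  assumes supp: "\<And>q i. q \<noteq> p \<Longrightarrow> Rep_ell2 v (prod_encode (q, i)) = 0"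
  shows "norm (unblock p v) = norm v"
proof (rule antisym [OF norm_unblock_le])
  have "(\<Sum>a<1::nat. (norm v)\<^sup>2) \<le> (norm (unblock p v))\<^sup>2"
  proof (rule sum_norm_le_box)
    fix P I :: nat
    have "(\<Sum>q<P. \<Sum>i<I. \<Sum>a<1::nat. (cmod (Rep_ell2 v (prod_encode (q, i))))\<^sup>2)
        = (\<Sum>q<P. if q = p then \<Sum>i<I. (cmod (Rep_ell2 v (prod_encode (p, i))))\<^sup>2 else 0)"
      by (rule sum.cong) (auto simp: supp)
    also have "\<dots> \<le> (\<Sum>i<I. (cmod (Rep_ell2 v (prod_encode (p, i))))\<^sup>2)"
      by (simp add: sum_nonneg)
    also have "\<dots> \<le> (norm (unblock p v))\<^sup>2"
      using sum_le_norm_ell2 [of "unblock p v"] by (simp add: unblock.rep_eq)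
    finally show "(\<Sum>q<P. \<Sum>i<I. \<Sum>a<1::nat. (cmod (Rep_ell2 v (prod_encode (q, i))))\<^sup>2)
      \<le> (norm (unblock p v))\<^sup>2" .
  qed
  then have "(norm v)\<^sup>2 \<le> (norm (unblock p v))\<^sup>2" by simp
  then show "norm v \<le> norm (unblock p v)" by (rule power2_le_imp_le) simp
qed

definition block :: "(ell2 \<Rightarrow>\<^sub>L ell2) \<Rightarrow> nat \<Rightarrow> ell2"
  where "block T p = unblock p (blinfun_apply T (ket p))"

lemma unblock_add: "unblock p (v + w) = unblock p v + unblock p w"
  by transfer simp

lemma unblock_scaleC: "unblock p (c *\<^sub>C v) = c *\<^sub>C unblock p v"
  by transfer simp

lemma unblock_scaleR: "unblock p (r *\<^sub>R v) = r *\<^sub>R unblock p v"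
  by transfer simp

lemma unblock_sum: "unblock p (\<Sum>b\<in>S. g b) = (\<Sum>b\<in>S. unblock p (g b))"
proof (induction S rule: infinite_finite_induct)
  case empty
  show ?case by simp (transfer, simp)
next
  case (infinite S)
  then show ?case by simp (transfer, simp)
qed (simp add: unblock_add)

lemma bounded_linear_block: "bounded_linear (\<lambda>T. block T p)"
proof (rule bounded_linear_intro [where K = 1])
  fix T :: "ell2 \<Rightarrow>\<^sub>L ell2"
  show "norm (block T p) \<le> norm T * 1"
    using order_trans [OF norm_unblock_le norm_blinfun [of T "ket p"], of p] by (simp add: block_def)
qed (simp_all add: block_def blinfun.add_left blinfun.scaleR_left unblock_add unblock_scaleR)

lemmas block_add = bounded_linear_block [THEN bounded_linear.axioms(1), THEN linear_add]
lemmas block_diff = bounded_linear_block [THEN bounded_linear.axioms(1), THEN linear_diff]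
lemmas block_zero = bounded_linear_block [THEN bounded_linear.axioms(1), THEN linear_0]

lemma norm_block_le: "norm (block T p) \<le> norm T"
  using order_trans [OF norm_unblock_le norm_blinfun [of T "ket p"], of p] by (simp add: block_def)

lemma block_scale_op: "block (scale_op c T) p = c *\<^sub>C block T p"
  by (simp add: block_def scale_op_apply unblock_scaleC)

text \<open>
  These are the operators that map the \<open>p\<close>-th basis vector into the \<open>p\<close>-th copy of \<open>\<ell>\<^sub>2\<close>, that is
  the \<open>\<ell>\<^sub>\<infinity>\<close>-sum of countably many copies of the column Hilbert space. The condition is an equation
  for each coordinate, which makes closedness in the operator norm immediate.
\<close>

definition column_sums :: "(ell2 \<Rightarrow>\<^sub>L ell2) set"
  where "column_sums = {T \<in> bounded_ops. \<forall>x p i.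
    Rep_ell2 (blinfun_apply T x) (prod_encode (p, i)) = Rep_ell2 x p * Rep_ell2 (block T p) i}"

lemma column_sums_coord:
  "T \<in> column_sums \<Longrightarrow>
    Rep_ell2 (blinfun_apply T x) (prod_encode (p, i)) = Rep_ell2 x p * Rep_ell2 (block T p) i"
  by (simp add: column_sums_def)

lemma column_sums_subset: "T \<in> column_sums \<Longrightarrow> T \<in> bounded_ops"
  by (simp add: column_sums_def)

lemma block_eqI:
  assumes "\<And>m j. block S (prod_encode (m, j)) = block T (prod_encode (m, j))"
  shows "block S p = block T p"
  by (metis assms prod_decode_inverse surj_pair)

lemma column_sums_eqI:
  assumes "S \<in> column_sums" "T \<in> column_sums" "\<And>p. block S p = block T p"
  shows "S = T"
proof (rule blinfun_eqI)
  fix x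
  have "Rep_ell2 (blinfun_apply S x) k = Rep_ell2 (blinfun_apply T x) k" for k
    using assms column_sums_coord [of S x "fst (prod_decode k)" "snd (prod_decode k)"]
      column_sums_coord [of T x "fst (prod_decode k)" "snd (prod_decode k)"] by simp
  then show "blinfun_apply S x = blinfun_apply T x"
    by (simp add: Rep_ell2_inject [symmetric] fun_eq_iff)
qed

text \<open>
  Linear combinations of \<open>p\<close>-th columns are supported in the \<open>p\<close>-th copy of \<open>\<ell>\<^sub>2\<close>, so that
  restricting them to this copy loses nothing.
\<close>

lemma norm_combination_block:
  assumes "\<And>b. b < n \<Longrightarrow> T b \<in> column_sums"
  shows "norm (\<Sum>b<n. z b *\<^sub>C blinfun_apply (T b) (ket p)) = norm (\<Sum>b<n. z b *\<^sub>C block (T b) p)"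
proof -
  have "norm (unblock p (\<Sum>b<n. z b *\<^sub>C blinfun_apply (T b) (ket p)))
      = norm (\<Sum>b<n. z b *\<^sub>C blinfun_apply (T b) (ket p))"
    by (rule norm_unblock)
      (auto intro!: sum.neutral simp: Rep_ell2_sum scaleC_ell2.rep_eq column_sums_coord assms ket.rep_eq)
  then show ?thesis by (simp add: unblock_sum unblock_scaleC block_def)
qed

text \<open>
  Vectors in different copies of \<open>\<ell>\<^sub>2\<close> are orthogonal; by Pythagoras an estimate for each block
  adds up to the estimate for the whole matrix. The matrix of the \<open>p\<close>-th blocks is a matrix of
  columns, so it acts on scalar vectors \<open>z\<close>.
\<close>

lemma mat_norm_le_blocks:
  assumes A: "\<And>a b. a < n \<Longrightarrow> b < n \<Longrightarrow> A a b \<in> column_sums" and K: "0 \<le> K"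
    and bound: "\<And>p z. L2_set (\<lambda>a. norm (\<Sum>b<n. z b *\<^sub>C block (A a b) p)) {..<n}
      \<le> K * L2_set (\<lambda>b. cmod (z b)) {..<n}"
  shows "mat_norm n A \<le> K"
proof (rule mat_norm_le [OF K])
  fix \<xi> :: "nat \<Rightarrow> ell2"
  assume \<xi>: "L2_set (\<lambda>j. norm (\<xi> j)) {..<n} \<le> 1"
  let ?w = "\<lambda>a. \<Sum>b<n. blinfun_apply (A a b) (\<xi> b)"
  let ?v = "\<lambda>p a. \<Sum>b<n. Rep_ell2 (\<xi> b) p *\<^sub>C block (A a b) p"
  have "(\<Sum>a<n. (norm (?w a))\<^sup>2) \<le> K\<^sup>2 * (\<Sum>b<n. (norm (\<xi> b))\<^sup>2)"
  proof (rule sum_norm_le_box)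
    fix P I
    have coord: "Rep_ell2 (?w a) (prod_encode (p, i)) = Rep_ell2 (?v p a) i"
      if "a < n" for a p i
      unfolding Rep_ell2_sum using that A by (auto simp: column_sums_coord scaleC_ell2.rep_eq)
    have "(\<Sum>p<P. \<Sum>i<I. \<Sum>a<n. (cmod (Rep_ell2 (?w a) (prod_encode (p, i))))\<^sup>2)
        = (\<Sum>p<P. \<Sum>a<n. \<Sum>i<I. (cmod (Rep_ell2 (?v p a) i))\<^sup>2)"
      by (subst sum.swap [of _ "{..<n}"]) (auto simp: coord)
    also have "\<dots> \<le> (\<Sum>p<P. \<Sum>a<n. (norm (?v p a))\<^sup>2)"
      by (intro sum_mono sum_le_norm_ell2)
    also have "\<dots> \<le> (\<Sum>p<P. K\<^sup>2 * (\<Sum>b<n. (cmod (Rep_ell2 (\<xi> b) p))\<^sup>2))"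
    proof (rule sum_mono)
      fix p
      have "(L2_set (\<lambda>a. norm (?v p a)) {..<n})\<^sup>2 \<le> (K * L2_set (\<lambda>b. cmod (Rep_ell2 (\<xi> b) p)) {..<n})\<^sup>2"
        by (intro power_mono bound L2_set_nonneg)
      then show "(\<Sum>a<n. (norm (?v p a))\<^sup>2) \<le> K\<^sup>2 * (\<Sum>b<n. (cmod (Rep_ell2 (\<xi> b) p))\<^sup>2)"
        by (simp add: L2_set_def power_mult_distrib sum_nonneg)
    qed
    also have "\<dots> = K\<^sup>2 * (\<Sum>b<n. \<Sum>p<P. (cmod (Rep_ell2 (\<xi> b) p))\<^sup>2)"
      by (subst sum.swap) (simp only: sum_distrib_left)
    also have "\<dots> \<le> K\<^sup>2 * (\<Sum>b<n. (norm (\<xi> b))\<^sup>2)"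
      by (intro mult_left_mono sum_mono sum_le_norm_ell2) auto
    finally show "(\<Sum>p<P. \<Sum>i<I. \<Sum>a<n. (cmod (Rep_ell2 (?w a) (prod_encode (p, i))))\<^sup>2)
      \<le> K\<^sup>2 * (\<Sum>b<n. (norm (\<xi> b))\<^sup>2)" .
  qed
  then have "(L2_set (\<lambda>a. norm (?w a)) {..<n})\<^sup>2 \<le> (K * L2_set (\<lambda>j. norm (\<xi> j)) {..<n})\<^sup>2"
    by (simp add: L2_set_def power_mult_distrib sum_nonneg)
  then have "L2_set (\<lambda>a. norm (?w a)) {..<n} \<le> K * L2_set (\<lambda>j. norm (\<xi> j)) {..<n}"
    by (rule power2_le_imp_le) (simp add: K L2_set_nonneg)
  also have "\<dots> \<le> K" using K \<xi> by (intro mult_left_le)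
  finally show "L2_set (\<lambda>a. norm (?w a)) {..<n} \<le> K" .
qed

text \<open>
  The \<open>p\<close>-th blocks are recovered by testing on vectors all of whose entries are multiples of the
  \<open>p\<close>-th basis vector.
\<close>

lemma blocks_le_mat_norm:
  assumes A: "\<And>a b. a < n \<Longrightarrow> b < n \<Longrightarrow> A a b \<in> column_sums"
  shows "L2_set (\<lambda>a. norm (\<Sum>b<n. z b *\<^sub>C block (A a b) p)) {..<n}
      \<le> mat_norm n A * L2_set (\<lambda>b. cmod (z b)) {..<n}"
proof -
  have "L2_set (\<lambda>a. norm (\<Sum>b<n. z b *\<^sub>C block (A a b) p)) {..<n}
      = L2_set (\<lambda>a. norm (\<Sum>b<n. z b *\<^sub>C blinfun_apply (A a b) (ket p))) {..<n}"
    using A by (intro L2_set_cong norm_combination_block [symmetric]) auto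
  also have "\<dots> = L2_set (\<lambda>a. norm (\<Sum>b<n. blinfun_apply (A a b) (z b *\<^sub>C ket p))) {..<n}"
    using A [THEN column_sums_subset] by (intro L2_set_cong) (auto simp: bounded_ops_def)
  also have "\<dots> \<le> mat_norm n A * L2_set (\<lambda>b. norm (z b *\<^sub>C ket p)) {..<n}"
    by (rule mat_norm_apply)
  finally show ?thesis by (simp add: norm_scaleC)
qed

definition diag_op :: "(nat \<Rightarrow> ell2) \<Rightarrow> (ell2 \<Rightarrow>\<^sub>L ell2)"
  where "diag_op y = Blinfun (\<lambda>x. Abs_ell2 (\<lambda>k. Rep_ell2 x (fst (prod_decode k))
    * Rep_ell2 (y (fst (prod_decode k))) (snd (prod_decode k))))"

context
  fixes y :: "nat \<Rightarrow> ell2"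
  assumes y: "bounded (range y)"
begin

lemma diag_op_coord:
  "Rep_ell2 (blinfun_apply (diag_op y) x) (prod_encode (p, i)) = Rep_ell2 x p * Rep_ell2 (y p) i"
proof -
  obtain K where K: "\<And>p. norm (y p) \<le> K" using y by (auto simp: bounded_iff)
  then have K0: "0 \<le> K" using norm_ge_zero order_trans by blast
  define g where "g x k = Rep_ell2 x (fst (prod_decode k))
    * Rep_ell2 (y (fst (prod_decode k))) (snd (prod_decode k))" for x k
  have box: "(\<Sum>p<P. \<Sum>i<I. (cmod (g x (prod_encode (p, i))))\<^sup>2) \<le> (K * norm x)\<^sup>2" for x P I
  proof -
    have "(\<Sum>p<P. \<Sum>i<I. (cmod (g x (prod_encode (p, i))))\<^sup>2)
        = (\<Sum>p<P. (cmod (Rep_ell2 x p))\<^sup>2 * (\<Sum>i<I. (cmod (Rep_ell2 (y p) i))\<^sup>2))"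
      by (simp add: g_def norm_mult power_mult_distrib sum_distrib_left)
    also have "\<dots> \<le> (\<Sum>p<P. (cmod (Rep_ell2 x p))\<^sup>2 * K\<^sup>2)"
      by (intro sum_mono mult_left_mono order_trans [OF sum_le_norm_ell2] power_mono K) auto
    also have "\<dots> = (\<Sum>p<P. (cmod (Rep_ell2 x p))\<^sup>2) * K\<^sup>2"
      by (simp add: sum_distrib_right)
    also have "\<dots> \<le> (norm x)\<^sup>2 * K\<^sup>2"
      by (intro mult_right_mono sum_le_norm_ell2) auto
    finally show ?thesis by (simp add: power_mult_distrib mult.commute)
  qed
  have summ: "summable (\<lambda>k. (cmod (g x k))\<^sup>2)" and le: "(\<Sum>k. (cmod (g x k))\<^sup>2) \<le> (K * norm x)\<^sup>2" for x
    by (rule summable_box [OF _ box, of x]; simp)+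
  have rep: "Rep_ell2 (Abs_ell2 (g x)) = g x" for x
    using summ by (intro Abs_ell2_inverse) simp
  have "bounded_linear (\<lambda>x. Abs_ell2 (g x))"
  proof (rule bounded_linear_intro [where K = K])
    show "Abs_ell2 (g (x + x')) = Abs_ell2 (g x) + Abs_ell2 (g x')" for x x'
      by (simp add: Rep_ell2_inject [symmetric] plus_ell2.rep_eq rep)
        (simp add: fun_eq_iff g_def plus_ell2.rep_eq algebra_simps)
    show "Abs_ell2 (g (r *\<^sub>R x)) = r *\<^sub>R Abs_ell2 (g x)" for r x
      by (simp add: Rep_ell2_inject [symmetric] scaleR_ell2.rep_eq rep)
        (simp add: fun_eq_iff g_def scaleR_ell2.rep_eq algebra_simps)
    show "norm (Abs_ell2 (g x)) \<le> norm x * K" for x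
    proof (rule power2_le_imp_le)
      show "(norm (Abs_ell2 (g x)))\<^sup>2 \<le> (norm x * K)\<^sup>2"
        using le [of x] by (simp add: norm_ell2_square rep mult.commute)
    qed (simp add: K0)
  qed
  then have "blinfun_apply (diag_op y) x = Abs_ell2 (g x)"
    unfolding diag_op_def g_def by (simp add: bounded_linear_Blinfun_apply)
  then show ?thesis by (simp add: rep) (simp add: g_def)
qed

lemma block_diag_op: "block (diag_op y) p = y p"
  by (simp add: Rep_ell2_inject [symmetric] fun_eq_iff block_def unblock.rep_eq diag_op_coord ket.rep_eq)

lemma diag_op_in_column_sums: "diag_op y \<in> column_sums"
proof -
  have "blinfun_apply (diag_op y) (c *\<^sub>C x) = c *\<^sub>C blinfun_apply (diag_op y) x" for c x
  proof -
    have "Rep_ell2 (blinfun_apply (diag_op y) (c *\<^sub>C x)) k = c * Rep_ell2 (blinfun_apply (diag_op y) x) k" for k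
      using diag_op_coord [of "c *\<^sub>C x" "fst (prod_decode k)" "snd (prod_decode k)"]
        diag_op_coord [of x "fst (prod_decode k)" "snd (prod_decode k)"]
      by (simp add: scaleC_ell2.rep_eq)
    then show ?thesis by (simp add: Rep_ell2_inject [symmetric] fun_eq_iff scaleC_ell2.rep_eq)
  qed
  then show ?thesis
    by (simp add: column_sums_def bounded_ops_def block_diag_op diag_op_coord)
qed

end

section \<open>The operator spaces\<close>

text \<open>
  The index \<open>p\<close> of a block encodes a pair \<open>(n, j)\<close>. Outside the exceptional set \<open>F\<close> of blocks,
  the column with index \<open>(n, j)\<close> has length \<open>n\<close>; blocks with \<open>n = 0\<close> vanish unless they are in \<open>F\<close>,
  which leaves \<open>(0, 0)\<close> free for one column of infinite length. The norms tend to \<open>0\<close> as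
  \<open>n \<rightarrow> \<infinity>\<close>, uniformly in \<open>j\<close>.
\<close>

definition column_space :: "(nat \<times> nat) set \<Rightarrow> (ell2 \<Rightarrow>\<^sub>L ell2) set"
  where "column_space F = {T \<in> column_sums.
    (\<forall>n j i. (n, j) \<notin> F \<longrightarrow> n \<le> i \<longrightarrow> Rep_ell2 (block T (prod_encode (n, j))) i = 0) \<and>
    (\<forall>e>0. \<exists>N. \<forall>n\<ge>N. \<forall>j. norm (block T (prod_encode (n, j))) \<le> e)}"

abbreviation col_plus_fin :: "(ell2 \<Rightarrow>\<^sub>L ell2) set"
  where "col_plus_fin \<equiv> column_space {(0, 0)}"

abbreviation fin_cols :: "(ell2 \<Rightarrow>\<^sub>L ell2) set"
  where "fin_cols \<equiv> column_space {}"

lemma column_space_column_sums: "T \<in> column_space F \<Longrightarrow> T \<in> column_sums"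
  by (simp add: column_space_def)

lemma column_space_support:
  "T \<in> column_space F \<Longrightarrow> (n, j) \<notin> F \<Longrightarrow> n \<le> i \<Longrightarrow> Rep_ell2 (block T (prod_encode (n, j))) i = 0"
  by (simp add: column_space_def)

lemma column_space_vanish:
  "T \<in> column_space F \<Longrightarrow> e > 0 \<Longrightarrow> \<exists>N. \<forall>n\<ge>N. \<forall>j. norm (block T (prod_encode (n, j))) \<le> e"
  by (simp add: column_space_def)

lemma column_space_mono: "F \<subseteq> G \<Longrightarrow> column_space F \<subseteq> column_space G"
  unfolding column_space_def by blast

lemma bounded_linear_Rep_ell2: "bounded_linear (\<lambda>x. Rep_ell2 x i)"
  by (rule bounded_linear_intro [where K = 1])
    (auto simp: plus_ell2.rep_eq scaleR_ell2.rep_eq coord_le_norm_ell2 scaleR_conv_of_real)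

lemma closed_column_space: "closed (column_space F)"
proof -
  note [continuous_intros] = bounded_linear.continuous_on [OF bounded_linear_Rep_ell2]
    bounded_linear.continuous_on [OF bounded_linear_scaleC]
    bounded_linear.continuous_on [OF bounded_linear_block]
  have "column_sums = {T. (\<forall>c x. blinfun_apply T (c *\<^sub>C x) = c *\<^sub>C blinfun_apply T x) \<and> (\<forall>x p i.
    Rep_ell2 (blinfun_apply T x) (prod_encode (p, i)) = Rep_ell2 x p * Rep_ell2 (block T p) i)}"
    by (auto simp: column_sums_def bounded_ops_def)
  also have "closed \<dots>"
    by (intro closed_Collect_conj closed_Collect_all closed_Collect_eq continuous_intros)
  finally have 1: "closed column_sums" .
  have 2: "closed {T. \<forall>n j i. (n, j) \<notin> F \<longrightarrow> n \<le> i \<longrightarrow> Rep_ell2 (block T (prod_encode (n, j))) i = 0}"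
    by (intro closed_Collect_all closed_Collect_imp closed_Collect_eq continuous_intros open_Collect_const)
  have 3: "closed {T. \<forall>e>0. \<exists>N. \<forall>n\<ge>N. \<forall>j. norm (block T (prod_encode (n, j))) \<le> e}" (is "closed ?V")
    unfolding closed_sequential_limits
  proof (intro allI impI CollectI, elim conjE)
    fix S T and e :: real
    assume S: "\<forall>k. S k \<in> ?V" and lim: "S \<longlonglongrightarrow> T" and e: "0 < e"
    \<comment> \<open>uniform convergence: one operator close to the limit provides the index \<open>N\<close>\<close>
    obtain k where k: "norm (S k - T) < e / 2"
      using LIMSEQ_D [OF lim, of "e / 2"] e by auto
    have "\<exists>N. \<forall>n\<ge>N. \<forall>j. norm (block (S k) (prod_encode (n, j))) \<le> e / 2"
      using S e half_gt_zero [of e] by (simp only: mem_Collect_eq)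
    then obtain N where N: "\<And>n j. n \<ge> N \<Longrightarrow> norm (block (S k) (prod_encode (n, j))) \<le> e / 2"
      by blast
    have "norm (block T (prod_encode (n, j))) \<le> e" if "n \<ge> N" for n j
    proof -
      let ?p = "prod_encode (n, j)"
      have "block T ?p = block (S k) ?p - block (S k - T) ?p" by (simp add: block_diff)
      then have "norm (block T ?p) \<le> norm (block (S k) ?p) + norm (block (S k - T) ?p)"
        by (metis norm_triangle_ineq4)
      also have "\<dots> \<le> e" using N [OF that, of j] norm_block_le [of "S k - T" ?p] k by simp
      finally show ?thesis .
    qed
    then show "\<exists>N. \<forall>n\<ge>N. \<forall>j. norm (block T (prod_encode (n, j))) \<le> e" by blast
  qed
  have "column_space F = column_sums
    \<inter> {T. \<forall>n j i. (n, j) \<notin> F \<longrightarrow> n \<le> i \<longrightarrow> Rep_ell2 (block T (prod_encode (n, j))) i = 0} \<inter> ?V"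
    by (auto simp: column_space_def)
  then show ?thesis using 1 2 3 by (simp add: closed_Int)
qed

lemma column_sums_add: "S \<in> column_sums \<Longrightarrow> T \<in> column_sums \<Longrightarrow> S + T \<in> column_sums"
  by (simp add: column_sums_def bounded_ops_def blinfun.add_left block_add plus_ell2.rep_eq
      scaleC_add_right algebra_simps)

lemma column_sums_scale: "T \<in> column_sums \<Longrightarrow> scale_op c T \<in> column_sums"
  by (simp add: column_sums_def bounded_ops_def scale_op_apply block_scale_op scaleC_ell2.rep_eq
      scaleC_scaleC mult.commute mult.left_commute)

lemma column_space_add:
  assumes S: "S \<in> column_space F" and T: "T \<in> column_space F"
  shows "S + T \<in> column_space F"
proof -
  have "\<exists>N. \<forall>n\<ge>N. \<forall>j. norm (block (S + T) (prod_encode (n, j))) \<le> e" if e: "e > 0" for e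
  proof -
    from e have "e / 2 > 0" by simp
    then obtain N M where N: "\<And>n j. n \<ge> N \<Longrightarrow> norm (block S (prod_encode (n, j))) \<le> e / 2"
      and M: "\<And>n j. n \<ge> M \<Longrightarrow> norm (block T (prod_encode (n, j))) \<le> e / 2"
      using column_space_vanish [OF S] column_space_vanish [OF T] by metis
    have "norm (block (S + T) (prod_encode (n, j))) \<le> e" if "n \<ge> max N M" for n j
      using norm_triangle_ineq [of "block S (prod_encode (n, j))" "block T (prod_encode (n, j))"]
        N [of n j] M [of n j] that unfolding block_add by linarith
    then show ?thesis by blast
  qed
  then show ?thesis
    using S T by (simp add: column_space_def column_sums_add block_add plus_ell2.rep_eq)
qed

lemma column_space_scale:
  assumes T: "T \<in> column_space F"
  shows "scale_op c T \<in> column_space F"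
proof -
  have "\<exists>N. \<forall>n\<ge>N. \<forall>j. norm (block (scale_op c T) (prod_encode (n, j))) \<le> e" if e: "e > 0" for e
  proof -
    have "e / (cmod c + 1) > 0" using e norm_ge_zero [of c] by (intro divide_pos_pos) linarith+
    then obtain N where N: "\<And>n j. n \<ge> N \<Longrightarrow> norm (block T (prod_encode (n, j))) \<le> e / (cmod c + 1)"
      using column_space_vanish [OF T] by metis
    have "norm (block (scale_op c T) (prod_encode (n, j))) \<le> e" if "n \<ge> N" for n j
    proof -
      have "norm (block (scale_op c T) (prod_encode (n, j)))
          \<le> (cmod c + 1) * norm (block T (prod_encode (n, j)))"
        by (simp add: block_scale_op norm_scaleC distrib_right)
      also have "\<dots> \<le> (cmod c + 1) * (e / (cmod c + 1))"
        by (intro mult_left_mono N that) simp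
      also have "\<dots> = e"
        using norm_ge_zero [of c] by (simp add: add_nonneg_eq_0_iff)
      finally show ?thesis .
    qed
    then show ?thesis by blast
  qed
  then show ?thesis
    using T by (simp add: column_space_def column_sums_scale block_scale_op scaleC_ell2.rep_eq)
qed

lemma column_space_zero: "0 \<in> column_space F"
  by (auto simp: column_space_def column_sums_def bounded_ops_def block_zero zero_ell2.rep_eq
      Rep_ell2_inject [symmetric] scaleC_ell2.rep_eq fun_eq_iff)

lemma scale_op_of_real: "scale_op (complex_of_real r) T = r *\<^sub>R T"
  by (rule blinfun_eqI) (simp add: scale_op_apply scaleC_of_real blinfun.scaleR_left)

lemma column_space_scaleR: "T \<in> column_space F \<Longrightarrow> r *\<^sub>R T \<in> column_space F"
  using column_space_scale [of T F "complex_of_real r"] by (simp add: scale_op_of_real)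

lemma column_space_diff: "S \<in> column_space F \<Longrightarrow> T \<in> column_space F \<Longrightarrow> S - T \<in> column_space F"
  using column_space_add [of S F "(-1) *\<^sub>R T"] column_space_scaleR [of T F "-1"] by simp

lemma operator_space_column_space: "operator_space (column_space F)"
  unfolding operator_space_def
  using column_space_zero column_space_add column_space_scale closed_column_space
    column_sums_subset [OF column_space_column_sums] by blast

section \<open>Compressions to finitely many coordinates\<close>

lemma cinner_add_left: "cinner (x + y) z = cinner x z + cinner (y :: 'a :: complex_hilbert) z"
  by (metis cinner_add_right cinner_commute complex_cnj_add)

lemma cinner_scaleC_left: "cinner (c *\<^sub>C x) y = cnj c * cinner x (y :: 'a :: complex_hilbert)"
  by (metis cinner_commute cinner_scaleC_right complex_cnj_mult)

lemma scaleC_zero_left: "0 *\<^sub>C x = (0 :: 'a :: complex_hilbert)"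
  by (metis scaleC_of_real of_real_0 scaleR_zero_left)

lemma scaleC_one: "1 *\<^sub>C x = (x :: 'a :: complex_hilbert)"
  by (metis scaleC_of_real of_real_1 scaleR_one)

lemma scaleC_zero_right: "c *\<^sub>C 0 = (0 :: 'a :: complex_hilbert)"
  by (metis scaleC_add_right add_cancel_right_right)

lemma cinner_zero_left: "cinner 0 x = (0 :: complex)"
  by (metis cinner_add_left add_cancel_right_right)

lemma cinner_zero_right: "cinner x 0 = (0 :: complex)"
  by (metis cinner_add_right add_cancel_right_right)

lemma cinner_diff_right: "cinner x (y - z) = cinner x y - cinner x (z :: 'a :: complex_hilbert)"
  by (metis cinner_add_right add_diff_cancel_right' diff_add_cancel)

lemma cinner_diff_left: "cinner (x - y) z = cinner x z - cinner y (z :: 'a :: complex_hilbert)"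
  by (metis cinner_add_left add_diff_cancel_right' diff_add_cancel)

lemma cinner_sum_right: "cinner x (\<Sum>i\<in>S. g i) = (\<Sum>i\<in>S. cinner x (g i :: 'a :: complex_hilbert))"
  by (induction S rule: infinite_finite_induct) (auto simp: cinner_add_right cinner_zero_right)

lemma cinner_sum_left: "cinner (\<Sum>i\<in>S. g i) x = (\<Sum>i\<in>S. cinner (g i :: 'a :: complex_hilbert) x)"
  by (induction S rule: infinite_finite_induct) (auto simp: cinner_add_left cinner_zero_left)

text \<open>
  Zero vectors are admitted besides an orthonormal system, so that the Gram-Schmidt process
  needs no assumption of linear independence.
\<close>

definition subnormal :: "nat \<Rightarrow> (nat \<Rightarrow> 'a :: complex_hilbert) \<Rightarrow> bool"
  where "subnormal n w \<longleftrightarrow> (\<forall>i<n. \<forall>k<n. i \<noteq> k \<longrightarrow> cinner (w i) (w k) = 0) \<and>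
    (\<forall>i<n. w i = 0 \<or> cinner (w i) (w i) = 1)"

definition span_proj :: "nat \<Rightarrow> (nat \<Rightarrow> 'a :: complex_hilbert) \<Rightarrow> 'a \<Rightarrow> 'a"
  where "span_proj n w x = (\<Sum>i<n. cinner (w i) x *\<^sub>C w i)"

lemma cinner_span_proj:
  assumes w: "subnormal n w" and k: "k < n"
  shows "cinner (w k) (span_proj n w x) = cinner (w k) x"
proof -
  have "cinner (w k) (span_proj n w x) = (\<Sum>i<n. cinner (w i) x * cinner (w k) (w i))"
    by (simp add: span_proj_def cinner_sum_right cinner_scaleC_right)
  also have "\<dots> = (\<Sum>i<n. if i = k then cinner (w k) x * cinner (w k) (w k) else 0)"
    using w k by (intro sum.cong) (auto simp: subnormal_def)
  also have "\<dots> = cinner (w k) x"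
    using w k by (auto simp: subnormal_def cinner_zero_left)
  finally show ?thesis .
qed

lemma cinner_span_proj_left: "cinner (span_proj n w x) y = (\<Sum>i<n. cnj (cinner (w i) x) * cinner (w i) y)"
  by (simp add: span_proj_def cinner_sum_left cinner_scaleC_left)

lemma norm_span_proj:
  assumes "subnormal n w"
  shows "norm (span_proj n w x) = L2_set (\<lambda>i. cmod (cinner (w i) x)) {..<n}"
proof -
  have "complex_of_real ((norm (span_proj n w x))\<^sup>2) = (\<Sum>i<n. cnj (cinner (w i) x) * cinner (w i) x)"
    unfolding cinner_self [symmetric] using assms by (simp add: cinner_span_proj_left cinner_span_proj)
  also have "\<dots> = complex_of_real (\<Sum>i<n. (cmod (cinner (w i) x))\<^sup>2)"
    unfolding of_real_sum complex_norm_square by (simp add: mult.commute)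
  finally have "(norm (span_proj n w x))\<^sup>2 = (\<Sum>i<n. (cmod (cinner (w i) x))\<^sup>2)"
    by (simp only: of_real_eq_iff)
  then show ?thesis
    unfolding L2_set_def by (metis norm_ge_zero real_sqrt_unique)
qed

lemma Bessel_inequality:
  assumes w: "subnormal n w"
  shows "L2_set (\<lambda>i. cmod (cinner (w i) x)) {..<n} \<le> norm x"
proof -
  let ?P = "span_proj n w x"
  have Px: "cinner ?P x = complex_of_real ((norm ?P)\<^sup>2)"
    unfolding cinner_self [symmetric] using w by (simp add: cinner_span_proj_left cinner_span_proj)
  then have xP: "cinner x ?P = complex_of_real ((norm ?P)\<^sup>2)"
    by (metis cinner_commute complex_cnj_complex_of_real)
  have "cinner (x - ?P) (x - ?P) = cinner x x - cinner ?P x - (cinner x ?P - cinner ?P ?P)"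
    by (simp only: cinner_diff_left cinner_diff_right)
  also have "\<dots> = complex_of_real ((norm x)\<^sup>2 - (norm ?P)\<^sup>2)"
    unfolding cinner_self Px xP by simp
  finally have "complex_of_real ((norm (x - ?P))\<^sup>2) = complex_of_real ((norm x)\<^sup>2 - (norm ?P)\<^sup>2)"
    unfolding cinner_self .
  then have "(norm (x - ?P))\<^sup>2 = (norm x)\<^sup>2 - (norm ?P)\<^sup>2"
    by (simp only: of_real_eq_iff)
  then have "(norm ?P)\<^sup>2 \<le> (norm x)\<^sup>2" by (metis diff_ge_0_iff_ge zero_le_power2)
  then have "norm ?P \<le> norm x" by (rule power2_le_imp_le) simp
  then show ?thesis by (simp add: norm_span_proj [OF w])
qed

lemma cinner_normalize:
  fixes r :: "'a :: complex_hilbert"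
  assumes "r \<noteq> 0"
  shows "cinner (complex_of_real (inverse (norm r)) *\<^sub>C r) (complex_of_real (inverse (norm r)) *\<^sub>C r) = 1"
  using assms by (simp add: cinner_self norm_scaleC norm_inverse)

lemma Cauchy_Schwarz_cinner: "cmod (cinner x y) \<le> norm x * norm (y :: 'a :: complex_hilbert)"
proof (cases "x = 0")
  case False
  let ?w = "complex_of_real (inverse (norm x)) *\<^sub>C x"
  have "subnormal 1 (\<lambda>_. ?w)"
    using cinner_normalize [OF False] by (simp add: subnormal_def)
  from Bessel_inequality [OF this, of y] have "cmod (cinner ?w y) \<le> norm y"
    by (simp add: L2_set_def lessThan_Suc)
  then show ?thesis using False by (simp add: cinner_scaleC_left norm_mult norm_divide norm_inverse field_simps)
qed (simp add: cinner_zero_left)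

text \<open>
  If a vector already lies in the span of its predecessors, its remainder \<open>r\<close> vanishes and so does the
  new member \<open>u\<close> of the system.
\<close>

lemma Gram_Schmidt:
  fixes v :: "nat \<Rightarrow> 'a :: complex_hilbert"
  shows "\<exists>w. subnormal n w \<and> (\<forall>a<n. span_proj n w (v a) = v a)"
proof (induction n)
  case 0
  show ?case by (simp add: subnormal_def)
next
  case (Suc n)
  then obtain w where w: "subnormal n w" and span: "\<And>a. a < n \<Longrightarrow> span_proj n w (v a) = v a" by blast
  define r where "r = v n - span_proj n w (v n)"
  define u where "u = complex_of_real (inverse (norm r)) *\<^sub>C r"
  define w' where "w' = w(n := u)"
  have wr: "cinner (w k) r = 0" if "k < n" for k
    using cinner_span_proj [OF w that] by (simp add: r_def cinner_diff_right)
  then have wu: "cinner (w k) u = 0" if "k < n" for k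
    using that by (simp add: u_def cinner_scaleC_right)
  then have uw: "cinner u (w k) = 0" if "k < n" for k
    using that by (metis cinner_commute complex_cnj_zero)
  have uP: "cinner u (span_proj n w x) = 0" for x
    by (simp add: span_proj_def cinner_sum_right cinner_scaleC_right uw)
  have uu: "u = 0 \<or> cinner u u = 1"
    using cinner_normalize [of r] by (cases "r = 0") (simp_all add: u_def scaleC_zero_right)
  have sub: "subnormal (Suc n) w'"
    using w wu uw uu by (auto simp: subnormal_def w'_def less_Suc_eq)
  have step: "span_proj (Suc n) w' x = span_proj n w x + cinner u x *\<^sub>C u" for x
    by (simp add: span_proj_def w'_def)
  have "span_proj (Suc n) w' (v a) = v a" if "a < Suc n" for a
  proof (cases "a = n")
    case True
    have "cinner u (v n) = cinner u r"
      using uP [of "v n"] by (simp add: r_def cinner_diff_right)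
    also have "\<dots> *\<^sub>C u = r"
      by (cases "r = 0") (simp_all add: u_def cinner_scaleC_left cinner_self power2_eq_square scaleC_scaleC
          scaleC_zero_right scaleC_one mult.assoc flip: of_real_inverse of_real_mult)
    finally show ?thesis using True by (simp add: step r_def)
  next
    case False
    then have "span_proj n w (v a) = v a" using span that by simp
    moreover from this have "cinner u (v a) = 0" using uP [of "v a"] by simp
    ultimately show ?thesis by (simp add: step scaleC_zero_left)
  qed
  then show ?case using sub by blast
qed

text \<open>
  Finite sequences with entries from a countable dense set of complex numbers are dense.
\<close>

lemma ell2_separable: "\<exists>D :: ell2 set. countable D \<and> (\<forall>x. \<forall>e>0. \<exists>d\<in>D. norm (x - d) < e)"
proof -
  obtain Q :: "complex set" where Q: "countable Q" "\<And>U. open U \<Longrightarrow> U \<noteq> {} \<Longrightarrow> \<exists>d\<in>Q. d \<in> U"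
    using countable_dense_exists by blast
  define el where "el l = Abs_ell2 (\<lambda>i. if i < length l then l ! i else 0)" for l :: "complex list"
  have rep: "Rep_ell2 (el l) i = (if i < length l then l ! i else 0)" for l i
  proof -
    have "summable (\<lambda>i. (cmod (if i < length l then l ! i else 0))\<^sup>2)"
      by (rule summable_finite [of "{..<length l}"]) auto
    then show ?thesis unfolding el_def by (subst Abs_ell2_inverse) auto
  qed
  have "\<exists>d\<in>el ` lists Q. norm (x - d) < e" if e: "e > 0" for x e
  proof -
    have "(\<lambda>N. \<Sum>i. (cmod (Rep_ell2 x (i + N)))\<^sup>2) \<longlonglongrightarrow> 0"
      by (rule suminf_exist_split2 [OF summable_Rep_ell2])
    from order_tendstoD(2) [OF this, of "e\<^sup>2 / 2"] e
    obtain N where N: "(\<Sum>i. (cmod (Rep_ell2 x (i + N)))\<^sup>2) < e\<^sup>2 / 2"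
      by (auto simp: eventually_sequentially)
    define \<delta> where "\<delta> = sqrt (e\<^sup>2 / (2 * (real N + 1)))"
    have \<delta>: "\<delta> > 0" "\<delta>\<^sup>2 = e\<^sup>2 / (2 * (real N + 1))" using e by (auto simp: \<delta>_def)
    have "\<exists>c\<in>Q. cmod (Rep_ell2 x i - c) < \<delta>" for i
      using Q(2) [of "ball (Rep_ell2 x i) \<delta>"] \<delta> by (auto simp: dist_norm)
    then obtain c where c: "\<And>i. c i \<in> Q" "\<And>i. cmod (Rep_ell2 x i - c i) < \<delta>" by metis
    let ?d = "el (map c [0..<N])"
    have "(norm (x - ?d))\<^sup>2 = (\<Sum>i. (cmod (Rep_ell2 (x - ?d) i))\<^sup>2)"
      by (rule norm_ell2_square)
    also have "\<dots> = (\<Sum>i. (cmod (Rep_ell2 (x - ?d) (i + N)))\<^sup>2) + (\<Sum>i<N. (cmod (Rep_ell2 (x - ?d) i))\<^sup>2)"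
      by (rule suminf_split_initial_segment [OF summable_Rep_ell2])
    also have "(\<Sum>i. (cmod (Rep_ell2 (x - ?d) (i + N)))\<^sup>2) = (\<Sum>i. (cmod (Rep_ell2 x (i + N)))\<^sup>2)"
      by (simp add: minus_ell2.rep_eq rep)
    also have "(\<Sum>i<N. (cmod (Rep_ell2 (x - ?d) i))\<^sup>2) \<le> (\<Sum>i<N. \<delta>\<^sup>2)"
      using c(2) by (intro sum_mono power_mono) (auto simp: minus_ell2.rep_eq rep intro: less_imp_le)
    also have "\<dots> \<le> e\<^sup>2 / 2"
      unfolding \<delta>(2) using e by (simp add: field_simps)
    finally have "(norm (x - ?d))\<^sup>2 < e\<^sup>2" using N by simp
    then have "norm (x - ?d) < e" using e by (simp add: power2_less_imp_less)
    moreover have "map c [0..<N] \<in> lists Q" using c(1) by auto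
    ultimately show ?thesis by blast
  qed
  moreover have "countable (el ` lists Q)" using Q(1) by simp
  ultimately show ?thesis by blast
qed

definition compress :: "nat \<Rightarrow> (nat \<Rightarrow> ell2) \<Rightarrow> ell2 \<Rightarrow> ell2"
  where "compress n q x = Abs_ell2 (\<lambda>i. if i < n then cinner (q i) x else 0)"

lemma Rep_compress: "Rep_ell2 (compress n q x) i = (if i < n then cinner (q i) x else 0)"
proof -
  have "summable (\<lambda>i. (cmod (if i < n then cinner (q i) x else 0))\<^sup>2)"
    by (rule summable_finite [of "{..<n}"]) auto
  then show ?thesis unfolding compress_def by (subst Abs_ell2_inverse) auto
qed

lemma norm_compress: "norm (compress n q x) = L2_set (\<lambda>i. cmod (cinner (q i) x)) {..<n}"
proof -
  have "(norm (compress n q x))\<^sup>2 = (\<Sum>i<n. (cmod (Rep_ell2 (compress n q x) i))\<^sup>2)"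
    unfolding norm_ell2_square by (rule suminf_finite) (auto simp: Rep_compress)
  then have "(norm (compress n q x))\<^sup>2 = (\<Sum>i<n. (cmod (cinner (q i) x))\<^sup>2)"
    by (simp add: Rep_compress)
  then show ?thesis
    unfolding L2_set_def by (metis norm_ge_zero real_sqrt_unique)
qed

lemma compress_add: "compress n q (x + y) = compress n q x + compress n q y"
  by (simp add: Rep_ell2_inject [symmetric] fun_eq_iff plus_ell2.rep_eq Rep_compress cinner_add_right)

lemma compress_scaleC: "compress n q (c *\<^sub>C x) = c *\<^sub>C compress n q x"
  by (simp add: Rep_ell2_inject [symmetric] fun_eq_iff scaleC_ell2.rep_eq Rep_compress cinner_scaleC_right)

lemma compress_sum: "compress n q (\<Sum>b\<in>S. g b) = (\<Sum>b\<in>S. compress n q (g b))"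
  by (simp add: Rep_ell2_inject [symmetric] fun_eq_iff Rep_ell2_sum Rep_compress cinner_sum_right)

text \<open>
  For given \<open>v\<close> the orthogonal projection onto the span of \<open>v 0, \<dots>, v (n - 1)\<close> preserves the norms
  of these vectors. Half of the orthonormal system that defines it is approximated from a
  countable dense set with total error at most \<open>1/4\<close>: the approximating map has norm at most
  \<open>1/2 + 1/4\<close>, and it shrinks the \<open>v a\<close> by no more than the factor \<open>1/2 - 1/4\<close>.
\<close>

lemma exists_norming_compressions:
  "\<exists>q :: nat \<Rightarrow> nat \<Rightarrow> ell2. (\<forall>j x. norm (compress n (q j) x) \<le> norm x) \<and>
    (\<forall>v :: nat \<Rightarrow> ell2. \<exists>j. \<forall>a<n. norm (v a) \<le> 4 * norm (compress n (q j) (v a)))"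
proof -
  obtain D :: "ell2 set" where D: "countable D" "\<And>x e. e > 0 \<Longrightarrow> \<exists>d\<in>D. norm (x - d) < e"
    using ell2_separable by blast
  define L where "L = {l \<in> lists D. \<forall>x. norm (compress n (\<lambda>i. l ! i) x) \<le> norm x}"
  have "countable L" unfolding L_def using D(1) by (simp add: countable_Collect)
  have ex: "\<exists>l\<in>L. \<forall>a<n. norm (v a) \<le> 4 * norm (compress n (\<lambda>i. l ! i) (v a))" for v :: "nat \<Rightarrow> ell2"
  proof -
    obtain w where w: "subnormal n w" and span: "\<And>a. a < n \<Longrightarrow> span_proj n w (v a) = v a"
      using Gram_Schmidt [of n v] by blast
    define u where "u i = complex_of_real (1 / 2) *\<^sub>C w i" for i
    have "\<exists>d\<in>D. norm (u i - d) < 1 / (4 * (real n + 1))" for i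
      by (rule D(2)) simp
    then obtain d where d: "\<And>i. d i \<in> D" "\<And>i. norm (u i - d i) < 1 / (4 * (real n + 1))" by metis
    have u: "L2_set (\<lambda>i. cmod (cinner (u i) x)) {..<n} = 1 / 2 * L2_set (\<lambda>i. cmod (cinner (w i) x)) {..<n}" for x
      by (subst L2_set_right_distrib) (simp_all add: u_def cinner_scaleC_left norm_mult)
    have err: "L2_set (\<lambda>i. cmod (cinner (u i - d i) x)) {..<n} \<le> 1 / 4 * norm x" for x
    proof -
      have "L2_set (\<lambda>i. cmod (cinner (u i - d i) x)) {..<n} \<le> (\<Sum>i<n. cmod (cinner (u i - d i) x))"
        by (rule L2_set_le_sum) simp
      also have "\<dots> \<le> (\<Sum>i<n. 1 / (4 * (real n + 1)) * norm x)"
        by (intro sum_mono order_trans [OF Cauchy_Schwarz_cinner] mult_right_mono less_imp_le [OF d(2)]) auto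
      also have "\<dots> = real n / (real n + 1) * (1 / 4 * norm x)" by simp
      also have "\<dots> \<le> 1 * (1 / 4 * norm x)"
        by (intro mult_right_mono) (auto simp: field_simps)
      finally show ?thesis by simp
    qed
    let ?l = "map d [0..<n]"
    have c: "norm (compress n (\<lambda>i. ?l ! i) x) = L2_set (\<lambda>i. cmod (cinner (d i) x)) {..<n}" for x
      unfolding norm_compress by (rule L2_set_cong) auto
    have "norm (compress n (\<lambda>i. ?l ! i) x) \<le> norm x" for x
    proof -
      have "L2_set (\<lambda>i. cmod (cinner (d i) x)) {..<n}
          \<le> L2_set (\<lambda>i. cmod (cinner (u i) x) + cmod (cinner (u i - d i) x)) {..<n}"
      proof (rule L2_set_mono)
        fix i
        show "cmod (cinner (d i) x) \<le> cmod (cinner (u i) x) + cmod (cinner (u i - d i) x)"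
          using norm_triangle_sub [of "cinner (d i) x" "cinner (u i) x"]
          by (simp add: cinner_diff_left norm_minus_commute)
      qed simp
      also have "\<dots> \<le> 1 / 2 * norm x + 1 / 4 * norm x"
        using Bessel_inequality [OF w, of x] err [of x] by (intro order_trans [OF L2_set_triangle_ineq]) (simp add: u)
      finally show ?thesis using norm_ge_zero [of x] unfolding c by linarith
    qed
    then have "?l \<in> L" using d(1) by (auto simp: L_def)
    moreover have "norm (v a) \<le> 4 * norm (compress n (\<lambda>i. ?l ! i) (v a))" if "a < n" for a
    proof -
      have "norm (v a) = L2_set (\<lambda>i. cmod (cinner (w i) (v a))) {..<n}"
        using norm_span_proj [OF w, of "v a"] span [OF that] by simp
      then have "1 / 2 * norm (v a) = L2_set (\<lambda>i. cmod (cinner (u i) (v a))) {..<n}"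
        by (simp add: u)
      also have "\<dots> \<le> L2_set (\<lambda>i. cmod (cinner (d i) (v a)) + cmod (cinner (u i - d i) (v a))) {..<n}"
      proof (rule L2_set_mono)
        fix i
        show "cmod (cinner (u i) (v a)) \<le> cmod (cinner (d i) (v a)) + cmod (cinner (u i - d i) (v a))"
          using norm_triangle_sub [of "cinner (u i) (v a)" "cinner (d i) (v a)"]
          by (simp add: cinner_diff_left)
      qed simp
      also have "\<dots> \<le> L2_set (\<lambda>i. cmod (cinner (d i) (v a))) {..<n} + 1 / 4 * norm (v a)"
        using err [of "v a"] by (intro order_trans [OF L2_set_triangle_ineq]) simp
      finally show ?thesis unfolding c by linarith
    qed
    ultimately show ?thesis by blast
  qed
  then have "L \<noteq> {}" by blast
  define q where "q j = (\<lambda>i. from_nat_into L j ! i)" for j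
  have "norm (compress n (q j) x) \<le> norm x" for j x
    using from_nat_into [OF \<open>L \<noteq> {}\<close>, of j] by (simp add: q_def L_def)
  moreover have "\<exists>j. \<forall>a<n. norm (v a) \<le> 4 * norm (compress n (q j) (v a))" for v :: "nat \<Rightarrow> ell2"
    using ex [of v] from_nat_into_surj [OF \<open>countable L\<close>] unfolding q_def by metis
  ultimately show ?thesis by blast
qed

section \<open>Embeddings at a fixed matrix level\<close>

lemma norm_le_blocks:
  assumes "T \<in> column_sums" "0 \<le> K" "\<And>p. norm (block T p) \<le> K"
  shows "norm T \<le> K"
proof -
  have "mat_norm 1 (\<lambda>_ _. T) \<le> K"
  proof (rule mat_norm_le_blocks)
    fix p and z :: "nat \<Rightarrow> complex"
    show "L2_set (\<lambda>a. norm (\<Sum>b<1::nat. z b *\<^sub>C block T p)) {..<1::nat} \<le> K * L2_set (\<lambda>b. cmod (z b)) {..<1}"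
      using mult_left_mono [OF assms(3) [of p] norm_ge_zero [of "z 0"]]
      by (simp add: L2_set_def lessThan_Suc norm_scaleC mult.commute)
  qed (use assms in auto)
  then show ?thesis unfolding mat_norm_one .
qed

text \<open>
  The even blocks receive the columns of finite length, the odd blocks with first index \<open>n\<close> the
  compressions of the infinite column to columns of length \<open>n\<close>; splitting the index \<open>j\<close> by parity
  makes room for both.
\<close>

definition spread :: "nat \<Rightarrow> (nat \<Rightarrow> nat \<Rightarrow> ell2) \<Rightarrow> (ell2 \<Rightarrow>\<^sub>L ell2) \<Rightarrow> (ell2 \<Rightarrow>\<^sub>L ell2)"
  where "spread n q T = diag_op (\<lambda>p. case prod_decode p of (m, j) \<Rightarrow>
    if even j then if m = 0 then 0 else block T (prod_encode (m, j div 2))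
    else if m = n then compress n (q (j div 2)) (block T (prod_encode (0, 0))) else 0)"

context
  fixes n :: nat and q :: "nat \<Rightarrow> nat \<Rightarrow> ell2"
  assumes contr: "\<And>j x. norm (compress n (q j) x) \<le> norm x"
begin

lemma norm_compress_block_le: "norm (compress n (q j) (block T p)) \<le> norm T"
  by (rule order_trans [OF contr norm_block_le])

lemma bounded_spread:
  "bounded (range (\<lambda>p. case prod_decode p of (m, j) \<Rightarrow>
    if even j then if m = 0 then 0 else block T (prod_encode (m, j div 2))
    else if m = n then compress n (q (j div 2)) (block T (prod_encode (0, 0))) else 0))"
  unfolding bounded_iff
  using norm_compress_block_le [of _ T]
  by (intro exI [of _ "norm T"]) (auto split: prod.split intro: norm_block_le)

lemma block_spread:
  "block (spread n q T) (prod_encode (m, j)) =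
    (if even j then if m = 0 then 0 else block T (prod_encode (m, j div 2))
    else if m = n then compress n (q (j div 2)) (block T (prod_encode (0, 0))) else 0)"
  unfolding spread_def by (subst block_diag_op [OF bounded_spread]) simp

lemma spread_column_sums: "spread n q T \<in> column_sums"
  unfolding spread_def by (rule diag_op_in_column_sums [OF bounded_spread])

lemma norm_spread_le: "norm (spread n q T) \<le> norm T"
proof (rule norm_le_blocks [OF spread_column_sums norm_ge_zero])
  fix p
  obtain m j where p: "p = prod_encode (m, j)" by (metis prod_decode_inverse surj_pair)
  show "norm (block (spread n q T) p) \<le> norm T"
    using norm_compress_block_le [of _ T] unfolding p block_spread by (auto intro: norm_block_le)
qed

lemma spread_add: "spread n q (S + T) = spread n q S + spread n q T"
  by (rule column_sums_eqI [OF spread_column_sums column_sums_add [OF spread_column_sums spread_column_sums]],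
      rule block_eqI) (simp add: block_spread block_add compress_add)

lemma spread_scale: "spread n q (scale_op c T) = scale_op c (spread n q T)"
  by (rule column_sums_eqI [OF spread_column_sums column_sums_scale [OF spread_column_sums]],
      rule block_eqI) (simp add: block_spread block_scale_op compress_scaleC scaleC_zero_right)

lemma spread_diff: "spread n q (S - T) = spread n q S - spread n q T"
  using spread_add [of "S - T" T] by (simp add: algebra_simps)

lemma spread_fin_cols:
  assumes T: "T \<in> col_plus_fin"
  shows "spread n q T \<in> fin_cols"
proof -
  have "Rep_ell2 (block (spread n q T) (prod_encode (m, j))) i = 0" if "m \<le> i" for m j i
    using that column_space_support [OF T, of m "j div 2" i]
    by (auto simp: block_spread zero_ell2.rep_eq Rep_compress)
  moreover have "\<exists>N. \<forall>m\<ge>N. \<forall>j. norm (block (spread n q T) (prod_encode (m, j))) \<le> e" if "e > 0" for e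
  proof -
    obtain N where N: "\<forall>m\<ge>N. \<forall>j. norm (block T (prod_encode (m, j))) \<le> e"
      using column_space_vanish [OF T \<open>e > 0\<close>] by blast
    have "\<forall>m\<ge>max N (Suc n). \<forall>j. norm (block (spread n q T) (prod_encode (m, j))) \<le> e"
      using N \<open>e > 0\<close> by (auto simp: block_spread)
    then show ?thesis by blast
  qed
  ultimately show ?thesis by (simp add: column_space_def spread_column_sums)
qed

text \<open>
  Up to a contraction, every block of the image is one of the original blocks.
\<close>

lemma mat_norm_spread_le:
  assumes A: "A \<in> matrices n col_plus_fin"
  shows "mat_norm n (amplification n (spread n q) A) \<le> mat_norm n A"
proof (rule mat_norm_le_blocks [OF _ mat_norm_nonneg])
  have A': "A a b \<in> column_sums" if "a < n" "b < n" for a b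
    using A that by (auto simp: matrices_def intro: column_space_column_sums)
  show "amplification n (spread n q) A a b \<in> column_sums" if "a < n" "b < n" for a b
    using that by (simp add: amplification_def spread_column_sums)
  fix p z
  obtain m j where p: "p = prod_encode (m, j)" by (metis prod_decode_inverse surj_pair)
  let ?B = "\<lambda>a. \<Sum>b<n. z b *\<^sub>C block (amplification n (spread n q) A a b) p"
  have B: "?B a = (\<Sum>b<n. z b *\<^sub>C (if even j then if m = 0 then 0 else block (A a b) (prod_encode (m, j div 2))
    else if m = n then compress n (q (j div 2)) (block (A a b) (prod_encode (0, 0))) else 0))"
    if "a < n" for a
    using that by (intro sum.cong) (auto simp: amplification_def p block_spread)
  have "\<exists>k. \<forall>a<n. norm (?B a) \<le> norm (\<Sum>b<n. z b *\<^sub>C block (A a b) k)"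
  proof (cases "even j")
    case True
    then show ?thesis
      by (intro exI [of _ "prod_encode (m, j div 2)"]) (cases "m = 0"; simp add: B scaleC_zero_right)
  next
    case False
    have "norm (\<Sum>b<n. z b *\<^sub>C compress n (q (j div 2)) (block (A a b) (prod_encode (0, 0))))
        \<le> norm (\<Sum>b<n. z b *\<^sub>C block (A a b) (prod_encode (0, 0)))" for a
      using contr [of "j div 2" "\<Sum>b<n. z b *\<^sub>C block (A a b) (prod_encode (0, 0))"]
      by (simp add: compress_sum compress_scaleC)
    with False show ?thesis
      by (intro exI [of _ "prod_encode (0, 0)"]) (cases "m = n"; simp add: B scaleC_zero_right)
  qed
  then obtain k where "\<And>a. a < n \<Longrightarrow> norm (?B a) \<le> norm (\<Sum>b<n. z b *\<^sub>C block (A a b) k)" by blast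
  then have "L2_set (\<lambda>a. norm (?B a)) {..<n} \<le> L2_set (\<lambda>a. norm (\<Sum>b<n. z b *\<^sub>C block (A a b) k)) {..<n}"
    by (intro L2_set_mono) auto
  also have "\<dots> \<le> mat_norm n A * L2_set (\<lambda>b. cmod (z b)) {..<n}"
    by (rule blocks_le_mat_norm [OF A'])
  finally show "L2_set (\<lambda>a. norm (?B a)) {..<n} \<le> mat_norm n A * L2_set (\<lambda>b. cmod (z b)) {..<n}" .
qed

text \<open>
  For a fixed scalar vector \<open>z\<close>, a matrix of infinite columns produces \<open>n\<close> vectors of \<open>\<ell>\<^sub>2\<close>, one for
  each row. One compression that does well on all of them simultaneously bounds their
  contribution by that of a single odd block.
\<close>

lemma mat_norm_le_spread:
  assumes A: "A \<in> matrices n col_plus_fin"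
    and norming: "\<And>v :: nat \<Rightarrow> ell2. \<exists>j. \<forall>a<n. norm (v a) \<le> 4 * norm (compress n (q j) (v a))"
  shows "mat_norm n A \<le> 4 * mat_norm n (amplification n (spread n q) A)"
proof (rule mat_norm_le_blocks)
  let ?A = "amplification n (spread n q) A"
  have A': "A a b \<in> col_plus_fin" if "a < n" "b < n" for a b
    using A that by (auto simp: matrices_def)
  then show "A a b \<in> column_sums" if "a < n" "b < n" for a b
    using that column_space_column_sums by blast
  show "0 \<le> 4 * mat_norm n ?A" by (simp add: mat_norm_nonneg)
  have spr: "block (?A a b) (prod_encode (m, j)) = block (spread n q (A a b)) (prod_encode (m, j))"
    if "a < n" "b < n" for a b m j
    using that by (simp add: amplification_def)
  fix p z
  obtain m j where p: "p = prod_encode (m, j)" by (metis prod_decode_inverse surj_pair)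
  have "\<exists>k. \<forall>a<n. norm (\<Sum>b<n. z b *\<^sub>C block (A a b) p) \<le> 4 * norm (\<Sum>b<n. z b *\<^sub>C block (?A a b) k)"
  proof (cases "m = 0")
    case False
    have "(\<Sum>b<n. z b *\<^sub>C block (?A a b) (prod_encode (m, 2 * j))) = (\<Sum>b<n. z b *\<^sub>C block (A a b) p)"
      if "a < n" for a
      using that False by (intro sum.cong) (auto simp: spr block_spread p)
    then have "norm (\<Sum>b<n. z b *\<^sub>C block (A a b) p)
        \<le> 4 * norm (\<Sum>b<n. z b *\<^sub>C block (?A a b) (prod_encode (m, 2 * j)))" if "a < n" for a
      using that by simp
    then show ?thesis by blast
  next
    case True
    show ?thesis
    proof (cases "j = 0")
      case True
      obtain l where l: "\<And>a. a < n \<Longrightarrow> norm (\<Sum>b<n. z b *\<^sub>C block (A a b) p)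
          \<le> 4 * norm (compress n (q l) (\<Sum>b<n. z b *\<^sub>C block (A a b) p))"
        using norming [of "\<lambda>a. \<Sum>b<n. z b *\<^sub>C block (A a b) p"] by blast
      have "(\<Sum>b<n. z b *\<^sub>C block (?A a b) (prod_encode (n, Suc (2 * l))))
          = compress n (q l) (\<Sum>b<n. z b *\<^sub>C block (A a b) p)" if "a < n" for a
        using that True \<open>m = 0\<close> by (simp add: compress_sum compress_scaleC spr block_spread p)
      with l have "norm (\<Sum>b<n. z b *\<^sub>C block (A a b) p)
          \<le> 4 * norm (\<Sum>b<n. z b *\<^sub>C block (?A a b) (prod_encode (n, Suc (2 * l))))" if "a < n" for a
        using that by simp
      then show ?thesis by blast
    next
      case False
      have "block (A a b) p = 0" if "a < n" "b < n" for a b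
        using column_space_support [OF A' [OF that], of 0 j] False
        by (simp add: p \<open>m = 0\<close> Rep_ell2_inject [symmetric] fun_eq_iff zero_ell2.rep_eq)
      then show ?thesis by (simp add: scaleC_zero_right)
    qed
  qed
  then obtain k where k: "\<And>a. a < n \<Longrightarrow>
    norm (\<Sum>b<n. z b *\<^sub>C block (A a b) p) \<le> 4 * norm (\<Sum>b<n. z b *\<^sub>C block (?A a b) k)" by blast
  then have "L2_set (\<lambda>a. norm (\<Sum>b<n. z b *\<^sub>C block (A a b) p)) {..<n}
      \<le> L2_set (\<lambda>a. 4 * norm (\<Sum>b<n. z b *\<^sub>C block (?A a b) k)) {..<n}"
    by (intro L2_set_mono) auto
  also have "\<dots> = 4 * L2_set (\<lambda>a. norm (\<Sum>b<n. z b *\<^sub>C block (?A a b) k)) {..<n}"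
    by (rule L2_set_right_distrib [symmetric]) simp
  also have "\<dots> \<le> 4 * (mat_norm n ?A * L2_set (\<lambda>b. cmod (z b)) {..<n})"
    by (intro mult_left_mono blocks_le_mat_norm) (auto simp: amplification_def spread_column_sums)
  finally show "L2_set (\<lambda>a. norm (\<Sum>b<n. z b *\<^sub>C block (A a b) p)) {..<n}
      \<le> 4 * mat_norm n ?A * L2_set (\<lambda>b. cmod (z b)) {..<n}" by simp
qed

end

lemma mat_norm_zero: "mat_norm n (\<lambda>_ _. 0) = 0"
  by (rule antisym [OF mat_norm_le mat_norm_nonneg]) (simp_all add: L2_set_def)

theorem exists_level_embedding:
  assumes "1 \<le> n"
  shows "\<exists>\<phi>. \<phi> \<in> col_plus_fin \<rightarrow> fin_cols \<and> inj_on \<phi> col_plus_fin \<and>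
    (\<forall>S T. \<phi> (S + T) = \<phi> S + \<phi> T) \<and> (\<forall>c T. \<phi> (scale_op c T) = scale_op c (\<phi> T)) \<and>
    (\<forall>T. norm (\<phi> T) \<le> norm T) \<and>
    (\<forall>A \<in> matrices n col_plus_fin. mat_norm n (amplification n \<phi> A) \<le> mat_norm n A \<and>
      mat_norm n A \<le> 4 * mat_norm n (amplification n \<phi> A))"
proof -
  obtain q :: "nat \<Rightarrow> nat \<Rightarrow> ell2" where q: "\<And>j x. norm (compress n (q j) x) \<le> norm x"
    "\<And>v :: nat \<Rightarrow> ell2. \<exists>j. \<forall>a<n. norm (v a) \<le> 4 * norm (compress n (q j) (v a))"
    using exists_norming_compressions [of n] by blast
  have "inj_on (spread n q) col_plus_fin"
  proof (rule inj_onI)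
    fix S T assume ST: "S \<in> col_plus_fin" "T \<in> col_plus_fin" and eq: "spread n q S = spread n q T"
    \<comment> \<open>the lower estimate at level \<open>n\<close> is applied to a matrix with a single nonzero entry\<close>
    define A :: "ell2 op_matrix" where "A i j = (if i = 0 \<and> j = 0 then S - T else 0)" for i j
    have z: "spread n q (S - T) = 0" "spread n q 0 = 0"
      using eq spread_diff [of n q, OF q(1), of S T] spread_diff [of n q, OF q(1), of 0 0] by simp_all
    have "A \<in> matrices n col_plus_fin"
      using ST \<open>1 \<le> n\<close> by (auto simp: matrices_def A_def column_space_diff column_space_zero)
    moreover have "amplification n (spread n q) A = (\<lambda>_ _. 0)"
      by (simp add: fun_eq_iff amplification_def A_def z)
    ultimately have "mat_norm n A \<le> 0"
      using mat_norm_le_spread [of n q, OF q(1) _ q(2), of A] by (simp add: mat_norm_zero)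
    then have "norm (A 0 0) \<le> 0"
      using entry_norm_le_mat_norm [where A = A and i = 0 and j = 0 and n = n] \<open>1 \<le> n\<close> by linarith
    then show "S = T" by (simp add: A_def)
  qed
  then show ?thesis
    using spread_fin_cols [of n q, OF q(1)] spread_add [of n q, OF q(1)] spread_scale [of n q, OF q(1)] norm_spread_le [of n q, OF q(1)]
      mat_norm_spread_le [of n q, OF q(1)] mat_norm_le_spread [of n q, OF q(1) _ q(2)]
    by (intro exI [of _ "spread n q"]) blast
qed

theorem linear_embedding_exists: "\<exists>f. linear_isomorphic_embedding col_plus_fin fin_cols f"
proof -
  obtain \<phi> where maps: "\<phi> \<in> col_plus_fin \<rightarrow> fin_cols" and inj: "inj_on \<phi> col_plus_fin"
    and add: "\<And>S T. \<phi> (S + T) = \<phi> S + \<phi> T" and scale: "\<And>c T. \<phi> (scale_op c T) = scale_op c (\<phi> T)"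
    and le: "\<And>T. norm (\<phi> T) \<le> norm T"
    and ge: "\<And>A. A \<in> matrices 1 col_plus_fin \<Longrightarrow> mat_norm 1 A \<le> 4 * mat_norm 1 (amplification 1 \<phi> A)"
    using exists_level_embedding [of 1] by auto
  have inv [simp]: "inv_into col_plus_fin \<phi> (\<phi> T) = T" if "T \<in> col_plus_fin" for T
    using inj that by (rule inv_into_f_f)
  \<comment> \<open>operator norms are matrix norms of level 1\<close>
  have "norm T \<le> 4 * norm (\<phi> T)" if "T \<in> col_plus_fin" for T
    using ge [of "\<lambda>i j :: nat. if i < 1 \<and> j < 1 then T else 0"] that
    unfolding mat_norm_one by (simp add: matrices_def amplification_def)
  moreover have "inv_into col_plus_fin \<phi> (\<phi> S + \<phi> T) = S + T" if "S \<in> col_plus_fin" "T \<in> col_plus_fin" for S T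
    unfolding add [symmetric] using that by (simp add: column_space_add)
  moreover have "inv_into col_plus_fin \<phi> (scale_op c (\<phi> T)) = scale_op c T" if "T \<in> col_plus_fin" for c T
    unfolding scale [symmetric] using that by (simp add: column_space_scale)
  ultimately have "bounded_map_on (\<phi> ` col_plus_fin) (inv_into col_plus_fin \<phi>)"
    unfolding bounded_map_on_def clinear_map_on_def by auto
  moreover have "bounded_map_on col_plus_fin \<phi>"
    unfolding bounded_map_on_def clinear_map_on_def using add scale le
    by (auto intro: exI [of _ 1])
  ultimately show ?thesis
    using maps inj unfolding linear_isomorphic_embedding_def by blast
qed

section \<open>Coarse equivalence of bounded subsets\<close>

lemma equi_coarse_embedding_if_bilipschitz:
  assumes maps: "\<And>n. 1 \<le> n \<Longrightarrow> F n \<in> A n \<rightarrow> B n"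
    and upper: "\<And>n x y. 1 \<le> n \<Longrightarrow> x \<in> A n \<Longrightarrow> y \<in> A n \<Longrightarrow> e n (F n x) (F n y) \<le> d n x y"
    and lower: "\<And>n x y. 1 \<le> n \<Longrightarrow> x \<in> A n \<Longrightarrow> y \<in> A n \<Longrightarrow> d n x y \<le> K * e n (F n x) (F n y)"
    and K: "K > 0"
  shows "equi_coarse_embedding A d B e F"
  unfolding equi_coarse_embedding_def
proof (intro conjI allI impI)
  fix t :: real
  have "expansion_modulus A d e F t \<le> ennreal t"
    unfolding expansion_modulus_def using upper
    by (auto intro!: SUP_least ennreal_leI intro: order_trans)
  also have "\<dots> < \<infinity>" by simp
  finally show "expansion_modulus A d e F t < \<infinity>" .
next
  have le: "ennreal (t / K) \<le> compression_modulus A d e F t" for t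
    unfolding compression_modulus_def using lower K
    by (auto intro!: INF_greatest ennreal_leI simp: pos_divide_le_eq mult.commute [of _ K])
      (meson order_trans)
  have "filterlim (\<lambda>t. inverse K * t) at_top at_top"
    using K by (intro filterlim_tendsto_pos_mult_at_top [OF tendsto_const _ filterlim_ident]) simp
  then have "((\<lambda>t. ennreal (t / K)) \<longlongrightarrow> top) at_top"
    by (simp add: ennreal_tendsto_top_eq_at_top divide_inverse mult.commute)
  then show "(compression_modulus A d e F \<longlongrightarrow> \<infinity>) at_top"
    unfolding infinity_ennreal_def
    by (rule tendsto_sandwich [OF always_eventually always_eventually _ tendsto_const, rotated 2])
      (use le in auto)
qed (use maps in auto)

text \<open>
  The map is to agree with \<open>f\<close> on \<open>A\<close> and its inverse with \<open>g\<close> on \<open>B\<close>. The injections \<open>h\<close> and \<open>k\<close>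
  only serve to show that what remains of the two sets has the same cardinality.
\<close>

lemma extend_partial_bijection:
  assumes A: "A \<subseteq> X" and B: "B \<subseteq> Y"
    and f: "inj_on f A" "f ` A \<subseteq> Y - B" and g: "inj_on g B" "g ` B \<subseteq> X - A"
    and h: "inj_on h X" "h ` X \<subseteq> Y - (B \<union> f ` A)" and k: "inj_on k Y" "k ` Y \<subseteq> X - (A \<union> g ` B)"
  shows "\<exists>F. bij_betw F X Y \<and> (\<forall>x\<in>A. F x = f x) \<and> (\<forall>y\<in>B. inv_into X F y = g y)"
proof -
  let ?D = "X - (A \<union> g ` B)" and ?E = "Y - (B \<union> f ` A)"
  obtain b where b: "bij_betw b ?D ?E"
  proof (rule exE [OF Schroeder_Bernstein [of h ?D ?E k]])
    show "inj_on h ?D" "inj_on k ?E" using h(1) k(1) by (auto intro: inj_on_subset)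
    show "h ` ?D \<subseteq> ?E" "k ` ?E \<subseteq> ?D" using h(2) k(2) by blast+
  qed
  define F where "F x = (if x \<in> A then f x else if x \<in> g ` B then inv_into B g x else b x)" for x
  have "bij_betw F A (f ` A)"
    using f(1) by (rule bij_betw_cong [THEN iffD2, OF _ inj_on_imp_bij_betw, rotated]) (simp add: F_def)
  moreover have "bij_betw F (g ` B) B"
    using bij_betw_inv_into [OF inj_on_imp_bij_betw [OF g(1)]]
    by (rule bij_betw_cong [THEN iffD2, rotated]) (use g(2) in \<open>auto simp: F_def\<close>)
  moreover have "bij_betw F ?D ?E"
    using b by (rule bij_betw_cong [THEN iffD2, rotated]) (auto simp: F_def)
  ultimately have "bij_betw F (A \<union> g ` B \<union> ?D) (f ` A \<union> B \<union> ?E)"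
    using f(2) by (intro bij_betw_combine) auto
  moreover have "A \<union> g ` B \<union> ?D = X" "f ` A \<union> B \<union> ?E = Y" using A B f(2) g(2) by auto
  ultimately have F: "bij_betw F X Y" by simp
  have "inv_into X F y = g y" if "y \<in> B" for y
  proof (rule inv_into_f_eq)
    show "inj_on F X" using F by (rule bij_betw_imp_inj_on)
    show "g y \<in> X" using g(2) that by blast
    show "F (g y) = y" using g that by (auto simp: F_def)
  qed
  then show ?thesis using F by (auto simp: F_def)
qed

text \<open>
  The matrix unit with its only nonzero entry in row \<open>k\<close> of the \<open>p\<close>-th column.
\<close>

definition unit_col :: "nat \<Rightarrow> nat \<Rightarrow> (ell2 \<Rightarrow>\<^sub>L ell2)"
  where "unit_col p k = diag_op (\<lambda>p'. if p' = p then ket k else 0)"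

lemma bounded_unit_col: "bounded (range (\<lambda>p'. if p' = p then ket k else 0))"
  unfolding bounded_iff by (rule exI [of _ 1]) auto

lemma block_unit_col: "block (unit_col p k) p' = (if p' = p then ket k else 0)"
  unfolding unit_col_def by (rule block_diag_op [OF bounded_unit_col])

lemma unit_col_column_space:
  assumes "p = prod_encode (m, j)" "(m, j) \<in> F \<or> k < m"
  shows "unit_col p k \<in> column_space F"
proof -
  have "\<exists>N. \<forall>n\<ge>N. \<forall>j. norm (block (unit_col p k) (prod_encode (n, j))) \<le> e" if "e > 0" for e
    using that assms by (intro exI [of _ "Suc m"]) (auto simp: block_unit_col)
  moreover have "unit_col p k \<in> column_sums"
    unfolding unit_col_def by (rule diag_op_in_column_sums [OF bounded_unit_col])
  ultimately show ?thesis
    using assms by (auto simp: column_space_def block_unit_col ket.rep_eq zero_ell2.rep_eq)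
qed

text \<open>
  The map \<open>S \<mapsto> S / (1 + \<parallel>S\<parallel>)\<close> squeezes a whole normed space into its unit ball; a translate
  of it places a copy of the space far away from any given ball.
\<close>

lemma inj_squash: "S = T"
  if "inverse (1 + norm S) *\<^sub>R S = inverse (1 + norm T) *\<^sub>R (T :: 'a :: real_normed_vector)"
proof -
  have pos: "1 + norm S > 0" "1 + norm T > 0" by (simp_all add: add_pos_nonneg)
  have "norm S / (1 + norm S) = norm T / (1 + norm T)"
    using arg_cong [OF that, of norm] pos by (simp add: divide_inverse mult.commute)
  then have "norm S = norm T" using pos by (simp add: field_simps)
  then show ?thesis using that pos by simp
qed

lemma norm_squash_le: "norm (inverse (1 + norm S) *\<^sub>R (S :: 'a :: real_normed_vector)) \<le> 1"
proof -
  have "1 + norm S > 0" by (simp add: add_pos_nonneg)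
  then show ?thesis by (simp add: field_simps)
qed

lemma mat_dist_amplification_translate:
  assumes diff: "\<And>S T. \<phi> (S - T) = \<phi> S - \<phi> T"
    and f: "\<And>i j. i < n \<Longrightarrow> j < n \<Longrightarrow> f (A i j) = \<phi> (A i j) + t \<and> f (B i j) = \<phi> (B i j) + t"
  shows "mat_dist n (amplification n f A) (amplification n f B) = mat_norm n (amplification n \<phi> (\<lambda>i j. A i j - B i j))"
proof -
  have "(\<lambda>i j. amplification n f A i j - amplification n f B i j) = amplification n \<phi> (\<lambda>i j. A i j - B i j)"
    using f by (auto simp: fun_eq_iff amplification_def diff)
  then show ?thesis by (simp add: mat_dist_def)
qed

lemma mat_ball_entry: "A \<in> mat_ball n X r \<Longrightarrow> i < n \<Longrightarrow> j < n \<Longrightarrow> A i j \<in> X \<and> norm (A i j) \<le> r"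
  using entry_norm_le_mat_norm [of i n j A] by (auto simp: mat_ball_def matrices_def)

lemma mat_ball_diff:
  assumes "A \<in> mat_ball n (column_space F) r" "B \<in> mat_ball n (column_space F) r"
  shows "(\<lambda>i j. A i j - B i j) \<in> matrices n (column_space F)"
  using assms by (auto simp: mat_ball_def matrices_def column_space_diff)

text \<open>
  Balls of radius \<open>n\<close> are moved to distance \<open>4 n\<close>, so that they end up between the radii \<open>3 n\<close> and
  \<open>5 n\<close>. Squeezed copies of the whole spaces at distance \<open>10 n\<close> avoid all this and
  provide the injections that make the complements equinumerous. Translations cancel in
  distances, so the bijection inherits the estimates of the linear maps.
\<close>

theorem level_bijection_exists:
  assumes "1 \<le> n"
  shows "\<exists>f. bij_betw f col_plus_fin fin_cols \<and>
    (\<forall>A \<in> mat_ball n col_plus_fin (real n). \<forall>B \<in> mat_ball n col_plus_fin (real n).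
      mat_dist n (amplification n f A) (amplification n f B) \<le> mat_dist n A B \<and>
      mat_dist n A B \<le> 4 * mat_dist n (amplification n f A) (amplification n f B)) \<and>
    (\<forall>A \<in> mat_ball n fin_cols (real n). \<forall>B \<in> mat_ball n fin_cols (real n).
      mat_dist n (amplification n (inv_into col_plus_fin f) A) (amplification n (inv_into col_plus_fin f) B)
        = mat_dist n A B)"
proof -
  let ?X = col_plus_fin and ?Y = fin_cols
  obtain \<phi> where maps: "\<phi> \<in> ?X \<rightarrow> ?Y" and inj: "inj_on \<phi> ?X"
    and add: "\<And>S T. \<phi> (S + T) = \<phi> S + \<phi> T" and norm_\<phi>: "\<And>T. norm (\<phi> T) \<le> norm T"
    and iso: "\<And>A. A \<in> matrices n ?X \<Longrightarrow> mat_norm n (amplification n \<phi> A) \<le> mat_norm n A \<and>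
      mat_norm n A \<le> 4 * mat_norm n (amplification n \<phi> A)"
    using exists_level_embedding [OF assms] by auto
  have diff: "\<phi> (S - T) = \<phi> S - \<phi> T" for S T
    using add [of "S - T" T] by (simp add: algebra_simps)
  have YX: "?Y \<subseteq> ?X" by (rule column_space_mono) simp
  \<comment> \<open>the direction of the translations, an element of both spaces\<close>
  define \<tau> where "\<tau> = unit_col (prod_encode (1, 0)) 0"
  have \<tau>: "\<tau> \<in> ?Y" unfolding \<tau>_def by (rule unit_col_column_space) auto
  have norm_\<tau>: "norm \<tau> = 1"
  proof (rule antisym)
    show "norm \<tau> \<le> 1"
      by (rule norm_le_blocks) (use \<tau> in \<open>auto simp: column_space_column_sums \<tau>_def block_unit_col\<close>)
    show "1 \<le> norm \<tau>"
      using norm_block_le [of \<tau> "prod_encode (1, 0)"] by (simp add: \<tau>_def block_unit_col)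
  qed
  define r where "r = real n"
  have r: "r \<ge> 1" using assms by (simp add: r_def)
  define near far where "near = (4 * r) *\<^sub>R \<tau>" and "far = (10 * r) *\<^sub>R \<tau>"
  have near_far: "near \<in> ?Y" "far \<in> ?Y" "norm near = 4 * r" "norm far = 10 * r"
    using \<tau> r by (simp_all add: near_def far_def column_space_scaleR norm_\<tau>)
  define sq where "sq S = inverse (1 + norm S) *\<^sub>R S" for S :: "ell2 \<Rightarrow>\<^sub>L ell2"
  have sq: "norm (sq S) \<le> 1" "sq S = sq T \<longleftrightarrow> S = T" "S \<in> ?Y \<Longrightarrow> sq S \<in> ?Y" for S T
    using norm_squash_le [of S] inj_squash [of S T] by (auto simp: sq_def column_space_scaleR)
  have near_bounds: "3 * r \<le> norm (S + near)" "norm (S + near) \<le> 5 * r" if "norm S \<le> r" for S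
    using that near_far(3) norm_triangle_ineq [of S near] norm_triangle_ineq2 [of near "- S"]
    by (simp_all add: add.commute)
  have far_bound: "9 * r \<le> norm (sq S + far)" for S
    using sq(1) [of S] near_far(4) r norm_triangle_ineq2 [of far "- sq S"] by (simp add: add.commute)
  let ?A = "{T \<in> ?X. norm T \<le> r}" and ?B = "{T \<in> ?Y. norm T \<le> r}"
  have "\<exists>f. bij_betw f ?X ?Y \<and> (\<forall>T\<in>?A. f T = \<phi> T + near) \<and> (\<forall>S\<in>?B. inv_into ?X f S = S + near)"
  proof (rule extend_partial_bijection [where h = "\<lambda>T. sq (\<phi> T) + far" and k = "\<lambda>S. sq S + far"])
    show "inj_on (\<lambda>T. \<phi> T + near) ?A" using inj by (auto simp: inj_on_def)
    show "inj_on (\<lambda>S. S + near) ?B" by (simp add: inj_on_def)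
    show "inj_on (\<lambda>T. sq (\<phi> T) + far) ?X" using inj by (auto simp: inj_on_def sq)
    show "inj_on (\<lambda>S. sq S + far) ?Y" by (simp add: inj_on_def sq)
    have \<phi>A: "norm (\<phi> T) \<le> r" if "norm T \<le> r" for T
      using norm_\<phi> [of T] that by simp
    show "(\<lambda>T. \<phi> T + near) ` ?A \<subseteq> ?Y - ?B"
      using maps near_far near_bounds(1) [OF \<phi>A] r by (force simp: column_space_add)
    show "(\<lambda>S. S + near) ` ?B \<subseteq> ?X - ?A"
      using YX near_far near_bounds(1) r by (force simp: column_space_add)
    have far_neq: "sq S + far \<noteq> T" if "norm T \<le> 5 * r" for S T
      using far_bound [of S] that r by auto
    show "(\<lambda>T. sq (\<phi> T) + far) ` ?X \<subseteq> ?Y - (?B \<union> (\<lambda>T. \<phi> T + near) ` ?A)"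
    proof (intro image_subsetI DiffI notI)
      fix T assume "T \<in> ?X"
      then show "sq (\<phi> T) + far \<in> ?Y"
        using maps near_far by (intro column_space_add sq) auto
      assume "sq (\<phi> T) + far \<in> ?B \<union> (\<lambda>T. \<phi> T + near) ` ?A"
      then show False
        using far_neq far_bound [of "\<phi> T"] near_bounds(2) [OF \<phi>A] r by fastforce
    qed
    show "(\<lambda>S. sq S + far) ` ?Y \<subseteq> ?X - (?A \<union> (\<lambda>S. S + near) ` ?B)"
    proof (intro image_subsetI DiffI notI)
      fix S assume "S \<in> ?Y"
      then show "sq S + far \<in> ?X"
        using YX near_far by (intro column_space_add) (auto intro: sq)
      assume "sq S + far \<in> ?A \<union> (\<lambda>S. S + near) ` ?B"
      then show False
        using far_neq far_bound [of S] near_bounds(2) r by fastforce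
    qed
  qed auto
  then obtain f where f: "bij_betw f ?X ?Y" "\<And>T. T \<in> ?X \<Longrightarrow> norm T \<le> r \<Longrightarrow> f T = \<phi> T + near"
    "\<And>S. S \<in> ?Y \<Longrightarrow> norm S \<le> r \<Longrightarrow> inv_into ?X f S = S + near" by auto
  have "mat_dist n (amplification n f A) (amplification n f B) \<le> mat_dist n A B \<and>
      mat_dist n A B \<le> 4 * mat_dist n (amplification n f A) (amplification n f B)"
    if AB: "A \<in> mat_ball n ?X (real n)" "B \<in> mat_ball n ?X (real n)" for A B
  proof -
    have "f (A i j) = \<phi> (A i j) + near \<and> f (B i j) = \<phi> (B i j) + near" if "i < n" "j < n" for i j
      using AB [THEN mat_ball_entry, OF that] f(2) by (simp add: r_def)
    from mat_dist_amplification_translate [OF diff this]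
    show ?thesis using iso [OF mat_ball_diff [OF AB]] by (simp add: mat_dist_def)
  qed
  moreover have "mat_dist n (amplification n (inv_into ?X f) A) (amplification n (inv_into ?X f) B) = mat_dist n A B"
    if AB: "A \<in> mat_ball n ?Y (real n)" "B \<in> mat_ball n ?Y (real n)" for A B
  proof -
    have "inv_into ?X f (A i j) = A i j + near \<and> inv_into ?X f (B i j) = B i j + near" if "i < n" "j < n" for i j
      using AB [THEN mat_ball_entry, OF that] f(3) by (simp add: r_def)
    from mat_dist_amplification_translate [of "\<lambda>T. T", OF refl this]
    have "mat_dist n (amplification n (inv_into ?X f) A) (amplification n (inv_into ?X f) B)
        = mat_norm n (amplification n (\<lambda>T. T) (\<lambda>i j. A i j - B i j))" .
    also have "amplification n (\<lambda>T. T) (\<lambda>i j. A i j - B i j) = (\<lambda>i j. A i j - B i j)"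
      using mat_ball_diff [OF AB] by (auto simp: amplification_def matrices_def fun_eq_iff)
    finally show ?thesis by (simp add: mat_dist_def)
  qed
  ultimately show ?thesis using f(1) by blast
qed

theorem coarsely_equivalent: "bounded_subsets_almost_completely_coarsely_equivalent col_plus_fin fin_cols"
proof -
  let ?X = col_plus_fin and ?Y = fin_cols
  have "\<forall>n. \<exists>f. 1 \<le> n \<longrightarrow> bij_betw f ?X ?Y \<and>
    (\<forall>A \<in> mat_ball n ?X (real n). \<forall>B \<in> mat_ball n ?X (real n).
      mat_dist n (amplification n f A) (amplification n f B) \<le> mat_dist n A B \<and>
      mat_dist n A B \<le> 4 * mat_dist n (amplification n f A) (amplification n f B)) \<and>
    (\<forall>A \<in> mat_ball n ?Y (real n). \<forall>B \<in> mat_ball n ?Y (real n).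
      mat_dist n (amplification n (inv_into ?X f) A) (amplification n (inv_into ?X f) B)
        = mat_dist n A B)"
    using level_bijection_exists by blast
  from choice [OF this] obtain f where bij: "\<And>n. 1 \<le> n \<Longrightarrow> bij_betw (f n) ?X ?Y"
    and f: "\<And>n A B. 1 \<le> n \<Longrightarrow> A \<in> mat_ball n ?X (real n) \<Longrightarrow> B \<in> mat_ball n ?X (real n) \<Longrightarrow>
      mat_dist n (amplification n (f n) A) (amplification n (f n) B) \<le> mat_dist n A B \<and>
      mat_dist n A B \<le> 4 * mat_dist n (amplification n (f n) A) (amplification n (f n) B)"
    and g: "\<And>n A B. 1 \<le> n \<Longrightarrow> A \<in> mat_ball n ?Y (real n) \<Longrightarrow> B \<in> mat_ball n ?Y (real n) \<Longrightarrow>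
      mat_dist n (amplification n (inv_into ?X (f n)) A) (amplification n (inv_into ?X (f n)) B)
        = mat_dist n A B" by metis
  have "equi_coarse_embedding (\<lambda>n. mat_ball n ?X (real n)) mat_dist (\<lambda>n. matrices n ?Y) mat_dist
    (\<lambda>n. amplification n (f n))"
  proof (rule equi_coarse_embedding_if_bilipschitz [where K = 4])
    show "amplification n (f n) \<in> mat_ball n ?X (real n) \<rightarrow> matrices n ?Y" if "1 \<le> n" for n
      using bij_betwE [OF bij [OF that]] by (auto simp: mat_ball_def matrices_def amplification_def)
  qed (use f in auto)
  moreover have "equi_coarse_embedding (\<lambda>n. mat_ball n ?Y (real n)) mat_dist (\<lambda>n. matrices n ?X) mat_dist
    (\<lambda>n. amplification n (inv_into ?X (f n)))"
  proof (rule equi_coarse_embedding_if_bilipschitz [where K = 1])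
    show "amplification n (inv_into ?X (f n)) \<in> mat_ball n ?Y (real n) \<rightarrow> matrices n ?X" if "1 \<le> n" for n
      using bij_betwE [OF bij_betw_inv_into [OF bij [OF that]]]
      by (auto simp: mat_ball_def matrices_def amplification_def)
  qed (use g in auto)
  ultimately show ?thesis
    unfolding bounded_subsets_almost_completely_coarsely_equivalent_def using bij by blast
qed

section \<open>There is no complete embedding\<close>

lemma completely_bounded_onD:
  assumes "completely_bounded_on X f"
  obtains C where "C > 0"
    "\<And>n A. 1 \<le> n \<Longrightarrow> A \<in> mat_ball n X 1 \<Longrightarrow> mat_norm n (amplification n f A) \<le> C"
proof -
  obtain C where C: "(SUP n \<in> {1..}. amplification_norm n X f) = ennreal C" "C \<ge> 0"
    using assms unfolding completely_bounded_on_def infinity_ennreal_def less_top_ennreal by auto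
  have "mat_norm n (amplification n f A) \<le> C + 1" if "1 \<le> n" "A \<in> mat_ball n X 1" for n A
  proof -
    have "ennreal (mat_norm n (amplification n f A)) \<le> amplification_norm n X f"
      unfolding amplification_norm_def by (rule SUP_upper [OF that(2)])
    also have "\<dots> \<le> ennreal C"
      unfolding C(1) [symmetric] by (rule SUP_upper) (use that in simp)
    finally show ?thesis using C(2) by (simp add: ennreal_le_iff)
  qed
  then show ?thesis using that [of "C + 1"] C(2) by simp
qed

lemma clinear_map_on_scale:
  "clinear_map_on X f \<Longrightarrow> T \<in> X \<Longrightarrow> f (scale_op c T) = scale_op c (f T)"
  by (simp add: clinear_map_on_def)

lemma clinear_map_on_zero:
  assumes "clinear_map_on X f" "0 \<in> X"
  shows "f 0 = 0"
proof -
  have "f 0 = f (scale_op (complex_of_real 0) 0)" unfolding scale_op_of_real by simp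
  also have "\<dots> = scale_op (complex_of_real 0) (f 0)" using assms by (rule clinear_map_on_scale)
  finally show ?thesis unfolding scale_op_of_real by simp
qed

lemma norm_sum_scale_ket: "norm (\<Sum>k<m. z k *\<^sub>C ket k) = L2_set (\<lambda>k. cmod (z k)) {..<m}"
proof -
  let ?x = "\<Sum>k<m. z k *\<^sub>C ket k"
  have rep: "Rep_ell2 ?x i = (if i < m then z i else 0)" for i
    by (simp add: Rep_ell2_sum scaleC_ell2.rep_eq ket.rep_eq if_distrib [of "(*) _"] cong: if_cong)
  have "(norm ?x)\<^sup>2 = (\<Sum>i<m. (cmod (Rep_ell2 ?x i))\<^sup>2)"
    unfolding norm_ell2_square by (rule suminf_finite) (auto simp: rep)
  also have "\<dots> = (\<Sum>i<m. (cmod (z i))\<^sup>2)" by (simp add: rep)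
  finally show ?thesis unfolding L2_set_def by (metis norm_ge_zero real_sqrt_unique)
qed

definition row_matrix :: "nat \<Rightarrow> (nat \<Rightarrow> 'h :: complex_hilbert \<Rightarrow>\<^sub>L 'h) \<Rightarrow> 'h op_matrix"
  where "row_matrix m T = (\<lambda>a b. if a = 0 \<and> b < m then T b else 0)"

definition col_matrix :: "nat \<Rightarrow> (nat \<Rightarrow> 'h :: complex_hilbert \<Rightarrow>\<^sub>L 'h) \<Rightarrow> 'h op_matrix"
  where "col_matrix m T = (\<lambda>a b. if b = 0 \<and> a < m then T a else 0)"

lemma row_matrix_matrices: "0 \<in> X \<Longrightarrow> (\<And>k. k < m \<Longrightarrow> T k \<in> X) \<Longrightarrow> row_matrix m T \<in> matrices m X"
  by (auto simp: row_matrix_def matrices_def)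

lemma col_matrix_matrices: "0 \<in> X \<Longrightarrow> (\<And>k. k < m \<Longrightarrow> T k \<in> X) \<Longrightarrow> col_matrix m T \<in> matrices m X"
  by (auto simp: col_matrix_def matrices_def)

lemma amplification_row_matrix:
  "f 0 = 0 \<Longrightarrow> amplification m f (row_matrix m T) = row_matrix m (\<lambda>k. f (T k))"
  by (auto simp: amplification_def row_matrix_def fun_eq_iff)

lemma amplification_col_matrix:
  "f 0 = 0 \<Longrightarrow> amplification m f (col_matrix m T) = col_matrix m (\<lambda>k. f (T k))"
  by (auto simp: amplification_def col_matrix_def fun_eq_iff)

lemma row_matrix_combination:
  "(\<Sum>b<m. z b *\<^sub>C block (row_matrix m T a b) p) = (if a = 0 then \<Sum>b<m. z b *\<^sub>C block (T b) p else 0)"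
  by (auto simp: row_matrix_def block_zero scaleC_zero_right)

lemma col_matrix_combination:
  assumes "a < m"
  shows "(\<Sum>b<m. z b *\<^sub>C block (col_matrix m T a b) p) = z 0 *\<^sub>C block (T a) p"
proof -
  have "(\<Sum>b<m. z b *\<^sub>C block (col_matrix m T a b) p) = (\<Sum>b<m. if b = 0 then z 0 *\<^sub>C block (T a) p else 0)"
    using assms by (intro sum.cong) (auto simp: col_matrix_def block_zero scaleC_zero_right)
  then show ?thesis using assms by simp
qed

text \<open>
  A row of orthonormal columns is an isometry of a finite-dimensional Hilbert space.
\<close>

lemma mat_norm_row_unit_col_le:
  "mat_norm m (row_matrix m (unit_col (prod_encode (0, 0)))) \<le> 1"
proof (rule mat_norm_le_blocks)
  have E: "unit_col (prod_encode (0, 0)) k \<in> column_sums" for k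
    by (rule column_space_column_sums [OF unit_col_column_space [of _ 0 0 "{(0, 0)}"]]) auto
  show "row_matrix m (unit_col (prod_encode (0, 0))) a b \<in> column_sums" for a b
    using E column_space_column_sums [OF column_space_zero] by (auto simp: row_matrix_def)
  fix p z
  let ?x = "\<Sum>b<m. z b *\<^sub>C block (unit_col (prod_encode (0, 0)) b) p"
  have le: "norm ?x \<le> L2_set (\<lambda>b. cmod (z b)) {..<m}"
    by (cases "p = prod_encode (0, 0)")
      (simp_all add: block_unit_col norm_sum_scale_ket scaleC_zero_right L2_set_nonneg)
  have "L2_set (\<lambda>a. norm (if a = 0 then ?x else 0)) {..<m} \<le> (\<Sum>a<m. norm (if a = 0 then ?x else 0))"
    by (rule L2_set_le_sum) simp
  also have "\<dots> \<le> norm ?x"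
    by (simp add: if_distrib [of norm] cong: if_cong)
  finally show "L2_set (\<lambda>a. norm (\<Sum>b<m. z b *\<^sub>C block (row_matrix m (unit_col (prod_encode (0, 0))) a b) p)) {..<m}
      \<le> 1 * L2_set (\<lambda>b. cmod (z b)) {..<m}"
    using le by (simp add: row_matrix_combination)
qed simp

lemma row_combination_le:
  assumes T: "\<And>k. k < m \<Longrightarrow> T k \<in> column_sums"
  shows "norm (\<Sum>b<m. z b *\<^sub>C block (T b) p) \<le> mat_norm m (row_matrix m T) * L2_set (\<lambda>b. cmod (z b)) {..<m}"
proof (cases "m = 0")
  case False
  have "norm (\<Sum>b<m. z b *\<^sub>C block (T b) p) = norm (\<Sum>b<m. z b *\<^sub>C block (row_matrix m T 0 b) p)"
    by (simp add: row_matrix_combination)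
  also have "\<dots> \<le> L2_set (\<lambda>a. norm (\<Sum>b<m. z b *\<^sub>C block (row_matrix m T a b) p)) {..<m}"
    by (rule member_le_L2_set [where f = "\<lambda>a. norm (\<Sum>b<m. z b *\<^sub>C block (row_matrix m T a b) p)"])
      (use False in auto)
  also have "\<dots> \<le> mat_norm m (row_matrix m T) * L2_set (\<lambda>b. cmod (z b)) {..<m}"
    using T column_space_column_sums [OF column_space_zero]
    by (intro blocks_le_mat_norm) (auto simp: row_matrix_def)
  finally show ?thesis .
qed simp

lemma mat_norm_col_matrix_le:
  assumes T: "\<And>k. k < m \<Longrightarrow> T k \<in> column_sums" and K: "0 \<le> K"
    and le: "\<And>p. L2_set (\<lambda>k. norm (block (T k) p)) {..<m} \<le> K"
  shows "mat_norm m (col_matrix m T) \<le> K"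
proof (rule mat_norm_le_blocks [OF _ K])
  show "col_matrix m T a b \<in> column_sums" for a b
    using T column_space_column_sums [OF column_space_zero] by (auto simp: col_matrix_def)
  fix p z
  show "L2_set (\<lambda>a. norm (\<Sum>b<m. z b *\<^sub>C block (col_matrix m T a b) p)) {..<m}
      \<le> K * L2_set (\<lambda>b. cmod (z b)) {..<m}"
  proof (cases "m = 0")
    case False
    have "L2_set (\<lambda>a. norm (\<Sum>b<m. z b *\<^sub>C block (col_matrix m T a b) p)) {..<m}
        = L2_set (\<lambda>a. cmod (z 0) * norm (block (T a) p)) {..<m}"
      by (rule L2_set_cong) (simp_all add: col_matrix_combination norm_scaleC)
    also have "\<dots> = cmod (z 0) * L2_set (\<lambda>a. norm (block (T a) p)) {..<m}"
      by (rule L2_set_right_distrib [symmetric]) simp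
    also have "\<dots> \<le> L2_set (\<lambda>b. cmod (z b)) {..<m} * K"
      using False by (intro mult_mono le member_le_L2_set L2_set_nonneg) auto
    finally show ?thesis by (simp add: mult.commute)
  qed simp
qed

lemma col_combination_le:
  assumes T: "\<And>k. k < m \<Longrightarrow> T k \<in> column_sums"
  shows "L2_set (\<lambda>k. norm (block (T k) p)) {..<m} \<le> mat_norm m (col_matrix m T)"
proof (cases "m = 0")
  case False
  let ?z = "\<lambda>b. if b = 0 then 1 else 0 :: complex"
  have "L2_set (\<lambda>k. norm (block (T k) p)) {..<m}
      = L2_set (\<lambda>a. norm (\<Sum>b<m. ?z b *\<^sub>C block (col_matrix m T a b) p)) {..<m}"
    by (rule L2_set_cong) (simp_all add: col_matrix_combination norm_scaleC)
  also have "\<dots> \<le> mat_norm m (col_matrix m T) * L2_set (\<lambda>b. cmod (?z b)) {..<m}"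
    using T column_space_column_sums [OF column_space_zero]
    by (intro blocks_le_mat_norm) (auto simp: col_matrix_def)
  also have "L2_set (\<lambda>b. cmod (?z b)) {..<m} = 1"
    using False by (simp add: L2_set_def if_distrib [of cmod] if_distrib [of "\<lambda>r. r\<^sup>2"] cong: if_cong)
  finally show ?thesis by simp
qed (simp add: mat_norm_nonneg)

text \<open>
  The row consisting of columns \<open>u k\<close> of length \<open>n\<close> is an \<open>n \<times> m\<close> matrix, and its Hilbert-Schmidt
  norm is at most \<open>sqrt n\<close> times its operator norm: each of its \<open>n\<close> rows has norm at most \<open>C\<close>, as
  one sees by testing on the conjugate of the row.
\<close>

lemma sum_norm_le_rank_times_row:
  fixes u :: "nat \<Rightarrow> ell2"
  assumes supp: "\<And>k i. k < m \<Longrightarrow> n \<le> i \<Longrightarrow> Rep_ell2 (u k) i = 0" and C: "0 \<le> C"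
    and row: "\<And>z. norm (\<Sum>k<m. z k *\<^sub>C u k) \<le> C * L2_set (\<lambda>k. cmod (z k)) {..<m}"
  shows "(\<Sum>k<m. (norm (u k))\<^sup>2) \<le> real n * C\<^sup>2"
proof -
  have coord: "(\<Sum>k<m. (cmod (Rep_ell2 (u k) i))\<^sup>2) \<le> C\<^sup>2" for i
  proof -
    \<comment> \<open>the conjugate of the \<open>i\<close>-th row, on which the row attains its norm\<close>
    let ?z = "\<lambda>k. cnj (Rep_ell2 (u k) i)"
    define R where "R = L2_set (\<lambda>k. cmod (?z k)) {..<m}"
    have R2: "R\<^sup>2 = (\<Sum>k<m. (cmod (Rep_ell2 (u k) i))\<^sup>2)"
      by (simp add: R_def L2_set_def sum_nonneg)
    have "Rep_ell2 (\<Sum>k<m. ?z k *\<^sub>C u k) i = complex_of_real (R\<^sup>2)"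
      unfolding R2 of_real_sum complex_norm_square by (simp add: Rep_ell2_sum scaleC_ell2.rep_eq mult.commute)
    then have "R\<^sup>2 \<le> norm (\<Sum>k<m. ?z k *\<^sub>C u k)"
      using coord_le_norm_ell2 [of "\<Sum>k<m. ?z k *\<^sub>C u k" i] by (simp add: norm_power)
    also have "\<dots> \<le> C * R" unfolding R_def by (rule row)
    finally have "R * R \<le> C * R" by (simp add: power2_eq_square)
    then have "R \<le> C" using C by (cases "R = 0") (auto simp: R_def L2_set_nonneg less_le)
    then show ?thesis unfolding R2 [symmetric] by (rule power_mono) (simp add: R_def L2_set_nonneg)
  qed
  have "(norm (u k))\<^sup>2 = (\<Sum>i<n. (cmod (Rep_ell2 (u k) i))\<^sup>2)" if "k < m" for k
    unfolding norm_ell2_square by (rule suminf_finite) (use supp that in \<open>auto simp: not_less\<close>)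
  then have "(\<Sum>k<m. (norm (u k))\<^sup>2) = (\<Sum>k<m. \<Sum>i<n. (cmod (Rep_ell2 (u k) i))\<^sup>2)" by simp
  also have "\<dots> = (\<Sum>i<n. \<Sum>k<m. (cmod (Rep_ell2 (u k) i))\<^sup>2)" by (rule sum.swap)
  also have "\<dots> \<le> (\<Sum>i<n. C\<^sup>2)" by (intro sum_mono coord)
  finally show ?thesis by simp
qed

text \<open>
  In the application \<open>h k n j\<close> is the squared norm of the block \<open>(n, j)\<close> of \<open>y\<^sub>k\<close>. The total mass of
  the weights is increased by 1 at each step while the weighted sums stay below \<open>2 C\<close>. Given
  weights with bound \<open>G C\<close>, their sums are small for \<open>n \<ge> N\<close>. The new unit of mass is distributed
  evenly over so many new indices that, by the bound \<open>n C\<close> for the sums over \<open>k\<close>, it contributes little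
  for \<open>n < N\<close>. For \<open>n \<ge> N\<close> it contributes at most \<open>C\<close>, to which the old weights add at most \<open>C / 2\<close>.
  The strict inequality \<open>G < 2\<close> leaves room for the next step.
\<close>

lemma spreading_weights:
  fixes h :: "nat \<Rightarrow> nat \<Rightarrow> nat \<Rightarrow> real"
  assumes C: "0 < C" and nonneg: "\<And>k n j. 0 \<le> h k n j" and le: "\<And>k n j. h k n j \<le> C"
    and rank: "\<And>m n j. (\<Sum>k<m. h k n j) \<le> real n * C"
    and vanish: "\<And>k e. e > 0 \<Longrightarrow> \<exists>N. \<forall>n\<ge>N. \<forall>j. h k n j \<le> e"
  shows "\<exists>\<mu> m G. (\<forall>k. 0 \<le> \<mu> k) \<and> (\<Sum>k<m. \<mu> k) = real r \<and> G < 2 \<and>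
    (\<forall>n j. (\<Sum>k<m. \<mu> k * h k n j) \<le> G * C)"
proof (induction r)
  case 0
  show ?case by (rule exI [of _ "\<lambda>_. 0"], rule exI [of _ 0], rule exI [of _ 0]) simp
next
  case (Suc r)
  then obtain \<mu> :: "nat \<Rightarrow> real" and m G where \<mu>: "\<And>k. 0 \<le> \<mu> k" "(\<Sum>k<m. \<mu> k) = real r" and G: "G < 2"
    and bound: "\<And>n j. (\<Sum>k<m. \<mu> k * h k n j) \<le> G * C" by blast
  let ?e = "C / (2 * (real r + 1))"
  have "\<exists>N. \<forall>n\<ge>N. \<forall>j. h k n j \<le> ?e" for k by (rule vanish) (use C in simp)
  then obtain N' where N': "\<And>k n j. N' k \<le> n \<Longrightarrow> h k n j \<le> ?e" by metis
  define N where "N = (\<Sum>k<m. N' k)"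
  have tail: "(\<Sum>k<m. \<mu> k * h k n j) \<le> C / 2" if "N \<le> n" for n j
  proof -
    have "N' k \<le> n" if "k < m" for k
      using member_le_sum [of k "{..<m}" N'] that \<open>N \<le> n\<close> by (simp add: N_def)
    then have "(\<Sum>k<m. \<mu> k * h k n j) \<le> (\<Sum>k<m. \<mu> k * ?e)"
      using \<mu>(1) N' by (intro sum_mono mult_left_mono) auto
    also have "\<dots> = real r / (real r + 1) * (C / 2)"
      by (simp only: sum_distrib_right [symmetric] \<mu>(2)) simp
    also have "\<dots> \<le> 1 * (C / 2)" using C by (intro mult_right_mono) auto
    finally show ?thesis by simp
  qed
  \<comment> \<open>the new mass contributes \<open>N C / s\<close> for \<open>n < N\<close>, which is to use up at most half of the gap between \<open>G\<close> and 2\<close>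
  obtain s :: nat where s: "real s > 2 * real N / (2 - G) + 1" using reals_Archimedean2 by blast
  have "0 \<le> 2 * real N / (2 - G)" using G by simp
  then have s0: "real s > 0" and "2 * real N / (2 - G) < real s" using s by linarith+
  then have "2 * real N < real s * (2 - G)" using G by (simp add: pos_divide_less_eq)
  then have sN: "real N / real s \<le> (2 - G) / 2"
    unfolding pos_divide_le_eq [OF s0] by (simp add: algebra_simps)
  define \<nu> where "\<nu> k = (if k < m then \<mu> k else 1 / real s)" for k
  have split: "(\<Sum>k<m + s. \<nu> k * c k) = (\<Sum>k<m. \<mu> k * c k) + (\<Sum>k=m..<m + s. c k) / real s" for c :: "nat \<Rightarrow> real"
  proof -
    have "(\<Sum>k<m + s. \<nu> k * c k) = (\<Sum>k<m. \<nu> k * c k) + (\<Sum>k=m..<m + s. \<nu> k * c k)"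
      by (simp add: lessThan_atLeast0 sum.atLeastLessThan_concat)
    then show ?thesis by (simp add: \<nu>_def sum_divide_distrib)
  qed
  have total: "(\<Sum>k<m + s. \<nu> k) = real (Suc r)"
    using split [of "\<lambda>_. 1"] s0 \<mu>(2) by simp
  define G' where "G' = max ((G + 2) / 2) (3 / 2)"
  have "(\<Sum>k<m + s. \<nu> k * h k n j) \<le> G' * C" for n j
  proof (cases "N \<le> n")
    case True
    have "(\<Sum>k=m..<m + s. h k n j) \<le> (\<Sum>k=m..<m + s. C)" by (intro sum_mono le)
    then have "(\<Sum>k=m..<m + s. h k n j) / real s \<le> C"
      using s0 by (simp add: field_simps)
    then have "(\<Sum>k<m + s. \<nu> k * h k n j) \<le> 3 / 2 * C"
      using tail [OF True, of j] unfolding split by linarith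
    also have "\<dots> \<le> G' * C" using C by (intro mult_right_mono) (auto simp: G'_def)
    finally show ?thesis .
  next
    case False
    have "(\<Sum>k=m..<m + s. h k n j) \<le> (\<Sum>k<m + s. h k n j)"
      using nonneg by (intro sum_mono2) auto
    also have "\<dots> \<le> real n * C" by (rule rank)
    also have "\<dots> \<le> real N * C" using False C by (intro mult_right_mono) auto
    finally have "(\<Sum>k=m..<m + s. h k n j) / real s \<le> real N * C / real s"
      using s0 by (intro divide_right_mono) auto
    also have "\<dots> = real N / real s * C" by simp
    also have "\<dots> \<le> (2 - G) / 2 * C" using C sN by (intro mult_right_mono) auto
    finally have "(\<Sum>k<m + s. \<nu> k * h k n j) \<le> G * C + (2 - G) / 2 * C"
      using bound [of n j] unfolding split by linarith
    also have "\<dots> = (G + 2) / 2 * C" by (simp add: field_simps)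
    also have "\<dots> \<le> G' * C" using C by (intro mult_right_mono) (auto simp: G'_def)
    finally show ?thesis .
  qed
  moreover have "G' < 2" using G by (simp add: G'_def)
  moreover have "\<forall>k. 0 \<le> \<nu> k" using \<mu>(1) s0 by (simp add: \<nu>_def)
  ultimately show ?case using total by blast
qed

text \<open>
  The rows of the \<open>y k = f (E k)\<close> are bounded by \<open>C\<close>. With weights \<open>\<mu>\<close> of total mass \<open>r\<close>, the
  column with entries \<open>sqrt (\<mu> k) y k\<close> has norm at most \<open>K = sqrt 2 * C\<close>, whereas its preimage
  has norm \<open>sqrt r\<close>. For \<open>r > (C' K)\<^sup>2\<close> this contradicts the complete bound \<open>C'\<close> for the inverse.
\<close>

theorem no_complete_embedding: "\<not> complete_isomorphic_embedding col_plus_fin fin_cols f"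
proof
  let ?X = col_plus_fin and ?Y = fin_cols
  assume "complete_isomorphic_embedding ?X ?Y f"
  then have maps: "f \<in> ?X \<rightarrow> ?Y" and inj: "inj_on f ?X" and cb: "completely_bounded_on ?X f"
    and cb': "completely_bounded_on (f ` ?X) (inv_into ?X f)"
    unfolding complete_isomorphic_embedding_def by auto
  obtain C where C: "C > 0"
    "\<And>n A. 1 \<le> n \<Longrightarrow> A \<in> mat_ball n ?X 1 \<Longrightarrow> mat_norm n (amplification n f A) \<le> C"
    using completely_bounded_onD [OF cb] by blast
  obtain C' where C': "C' > 0"
    "\<And>n A. 1 \<le> n \<Longrightarrow> A \<in> mat_ball n (f ` ?X) 1 \<Longrightarrow> mat_norm n (amplification n (inv_into ?X f) A) \<le> C'"
    using completely_bounded_onD [OF cb'] by blast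
  have lin: "clinear_map_on ?X f" using cb by (simp add: completely_bounded_on_def)
  have f0: "f 0 = 0" by (rule clinear_map_on_zero [OF lin column_space_zero])
  define E where "E = unit_col (prod_encode (0, 0))"
  have E: "E k \<in> ?X" for k unfolding E_def by (rule unit_col_column_space) auto
  define y where "y k = f (E k)" for k
  have y: "y k \<in> ?Y" for k using maps E by (auto simp: y_def)
  have row: "norm (\<Sum>k<m. z k *\<^sub>C block (y k) p) \<le> C * L2_set (\<lambda>k. cmod (z k)) {..<m}" for m z p
  proof (cases "m = 0")
    case False
    have "row_matrix m E \<in> mat_ball m ?X 1"
      using mat_norm_row_unit_col_le [of m] E column_space_zero
      by (simp add: mat_ball_def row_matrix_matrices E_def)
    from C(2) [OF _ this] have "mat_norm m (row_matrix m y) \<le> C"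
      using False by (simp add: amplification_row_matrix f0 y_def [abs_def])
    then have "mat_norm m (row_matrix m y) * L2_set (\<lambda>k. cmod (z k)) {..<m} \<le> C * L2_set (\<lambda>k. cmod (z k)) {..<m}"
      by (intro mult_right_mono L2_set_nonneg)
    then show ?thesis
      using row_combination_le [of m y z p] column_space_column_sums [OF y] by (meson order_trans)
  qed simp
  define h where "h k n j = (norm (block (y k) (prod_encode (n, j))))\<^sup>2" for k n j
  have le: "h k n j \<le> C\<^sup>2" for k n j
  proof -
    let ?z = "\<lambda>b. if b = k then 1 else 0 :: complex"
    let ?p = "prod_encode (n, j)"
    have "(\<Sum>b<Suc k. ?z b *\<^sub>C block (y b) ?p) = (\<Sum>b<Suc k. if b = k then block (y k) ?p else 0)"
      by (rule sum.cong) (auto simp: scaleC_one scaleC_zero_left)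
    moreover have "L2_set (\<lambda>b. cmod (?z b)) {..<Suc k} = 1"
      by (simp add: L2_set_def if_distrib [of cmod] if_distrib [of "\<lambda>r. r\<^sup>2"] cong: if_cong)
    ultimately have "norm (block (y k) ?p) \<le> C" using row [of ?z ?p "Suc k"] by (simp only: mult_1_right) simp
    then show ?thesis unfolding h_def by (rule power_mono) simp
  qed
  have rank: "(\<Sum>k<m. h k n j) \<le> real n * C\<^sup>2" for m n j
    unfolding h_def
    by (rule sum_norm_le_rank_times_row) (use column_space_support [OF y] C(1) row in auto)
  have vanish: "\<exists>N. \<forall>n\<ge>N. \<forall>j. h k n j \<le> e" if e: "e > 0" for k e
  proof -
    obtain N where "\<forall>n\<ge>N. \<forall>j. norm (block (y k) (prod_encode (n, j))) \<le> sqrt e"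
      using column_space_vanish [OF y, of "sqrt e" k] e by auto
    then show ?thesis unfolding h_def by (metis norm_ge_zero power_mono real_sqrt_pow2 e less_imp_le)
  qed
  define K where "K = sqrt 2 * C"
  have K: "K > 0" "K\<^sup>2 = 2 * C\<^sup>2" using C(1) by (simp_all add: K_def power_mult_distrib)
  obtain r :: nat where r: "real r > (C' * K)\<^sup>2" using reals_Archimedean2 by blast
  obtain \<mu> :: "nat \<Rightarrow> real" and m G where \<mu>: "\<And>k. 0 \<le> \<mu> k" "(\<Sum>k<m. \<mu> k) = real r" and G: "G < 2"
    and bound: "\<And>n j. (\<Sum>k<m. \<mu> k * h k n j) \<le> G * C\<^sup>2"
    using spreading_weights [of "C\<^sup>2" h r] C(1) le rank vanish by (auto simp: h_def)
  have m: "1 \<le> m"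
  proof (rule ccontr)
    assume "\<not> 1 \<le> m"
    then have "real r = 0" using \<mu>(2) by (simp add: not_le)
    then show False using r zero_le_power2 [of "C' * K"] by simp
  qed
  \<comment> \<open>normalised so that the column of the \<open>c k y k\<close> lies in the unit ball\<close>
  define c where "c k = complex_of_real (sqrt (\<mu> k) / K)" for k
  have norm_c: "cmod (c k) = sqrt (\<mu> k) / K" for k using \<mu>(1) K(1) by (simp add: c_def norm_divide)
  define D where "D k = scale_op (c k) (E k)" for k
  have D: "D k \<in> ?X" for k unfolding D_def by (rule column_space_scale [OF E])
  have fD: "f (D k) = scale_op (c k) (y k)" for k
    unfolding D_def y_def by (rule clinear_map_on_scale [OF lin E])
  have "mat_norm m (col_matrix m (\<lambda>k. f (D k))) \<le> 1"
  proof (rule mat_norm_col_matrix_le)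
    show "f (D k) \<in> column_sums" for k using maps D column_space_column_sums by blast
    fix p
    obtain n j where p: "p = prod_encode (n, j)" by (metis prod_decode_inverse surj_pair)
    have "(\<Sum>k<m. (norm (block (f (D k)) p))\<^sup>2) = (\<Sum>k<m. \<mu> k * h k n j) / K\<^sup>2"
      by (simp add: fD block_scale_op norm_scaleC norm_c h_def p power_mult_distrib power_divide \<mu>(1)
          sum_divide_distrib)
    also have "\<dots> \<le> G * C\<^sup>2 / K\<^sup>2" by (intro divide_right_mono bound) simp
    also have "\<dots> \<le> 1" using G C(1) by (simp add: K(2) field_simps)
    finally show "L2_set (\<lambda>k. norm (block (f (D k)) p)) {..<m} \<le> 1"
      by (simp add: L2_set_def)
  qed simp
  moreover have "0 \<in> f ` ?X" using f0 column_space_zero [of "{(0, 0)}"] by (metis imageI)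
  ultimately have "col_matrix m (\<lambda>k. f (D k)) \<in> mat_ball m (f ` ?X) 1"
    using D by (simp add: mat_ball_def col_matrix_matrices)
  from C'(2) [OF m this]
  have "mat_norm m (col_matrix m (\<lambda>k. inv_into ?X f (f (D k)))) \<le> C'"
    using inv_into_f_f [OF inj column_space_zero] by (simp add: amplification_col_matrix f0)
  then have "mat_norm m (col_matrix m D) \<le> C'"
    using inv_into_f_f [OF inj D] by simp
  then have "L2_set (\<lambda>k. norm (block (D k) (prod_encode (0, 0)))) {..<m} \<le> C'"
    using col_combination_le [of m D "prod_encode (0, 0)"] column_space_column_sums [OF D]
    by (meson order_trans)
  then have "sqrt (\<Sum>k<m. \<mu> k / K\<^sup>2) \<le> C'"
    by (simp add: L2_set_def D_def block_scale_op E_def block_unit_col norm_scaleC norm_c power_divide \<mu>(1))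
  then have "sqrt (real r / K\<^sup>2) \<le> C'"
    by (simp add: sum_divide_distrib [symmetric] \<mu>(2))
  then have "real r / K\<^sup>2 \<le> C'\<^sup>2"
    by (rule sqrt_le_D)
  then show False using r K(1) by (simp add: field_simps power_mult_distrib)
qed

theorem theorem1p8:
  shows "\<exists>(X :: (ell2 \<Rightarrow>\<^sub>L ell2) set) (Y :: (ell2 \<Rightarrow>\<^sub>L ell2) set).
    operator_space X \<and> operator_space Y \<and>
    (\<exists>f. linear_isomorphic_embedding X Y f) \<and>
    \<not> (\<exists>f. complete_isomorphic_embedding X Y f) \<and>
    bounded_subsets_almost_completely_coarsely_equivalent X Y"
  using operator_space_column_space linear_embedding_exists no_complete_embedding coarsely_equivalent
  by blast

end
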